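(* For every $p\in(1,2]$, the spherical Fourier transform $f\mapsto\hat f$ is a topological isomorphism from $\mathcal S_p(\mathfrak X)^{\#}$ onto $\mathcal H(S_p)^{\#}$.
   Context: $\mathfrak X$ is a homogeneous tree of degree $q+1$, $q\ge2$, identified with its vertex set, with graph distance $d$, base vertex $o$, and $|x|=d(o,x)$. Put $\tau=2\pi/\log q$, $\delta_p=\frac1p-\frac12$, $S_p=\{z\in\mathbb C:|\Im z|\le|\delta_p|\}$ (so $S_2=\mathbb R$), with interior $S_p^\circ$. The boundary $\Omega$ is the set of geodesic rays $(\omega_0=o,\omega_1,\dots)$ from $o$ with canonical probability measure $\nu$ (rays through a vertex $v$ with $|v|=n\ge1$ have measure $\frac{1}{(q+1)q^{n-1}}$); $h_\omega(x)=\lim_n(n-d(x,\omega_n))$ and the spherical function is $\phi_z(x)=\int_\Omega q^{(1/2+iz)h_\omega(x)}d\nu(\omega)$, equivalently $\phi_z(x)=\mathbf c(z)q^{(iz-1/2)|x|}+\mathbf c(-z)q^{(-iz-1/2)|x|}$ for $z\notin(\tau/2)\mathbb Z$ with $\mathbf c(z)=\frac{q^{1/2}}{q+1}\frac{q^{1/2+iz}-q^{-1/2-iz}}{q^{iz}-q^{-iz}}$. A function is radial if it depends only on $|x|$. $\mathcal S_p(\mathfrak X)$ is the Fréchet space of functions $f$ on $\mathfrak X$ with $\nu_m(f)=\sup_x(1+|x|)^mq^{|x|/p}|f(x)|<\infty$ for all $m\in\mathbb N$, and $\mathcal S_p(\mathfrak X)^{\#}$ its (closed) subspace of radial functions. The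 spherical Fourier transform of a radial $f$ is $\hat f(z)=\sum_{x\in\mathfrak X}f(x)\phi_z(x)$. $\mathcal H(S_p)^{\#}$ is the space of even, $\tau$-periodic functions $g$ on $S_p$ which are holomorphic on $S_p^\circ$, continuous on $S_p$, and satisfy $\mu_m(g)=\sup_{z\in S_p}|g^{(m)}(z)|<\infty$ for all $m\in\mathbb N$ (for $p=2$: even $\tau$-periodic smooth functions on $\mathbb R$), topologized by the seminorms $\mu_m$. *)

theory Defs
  imports "HOL-Analysis.Analysis"
begin

text \<open>Concrete model: vertices are reduced words over the alphabet {0..q} (no two
consecutive letters equal), i.e. the Cayley graph of the free product of q+1 copies
of Z/2; it is the homogeneous tree of degree q+1. Edges join a word to its one-letter
extensions. The base vertex o is the empty word, and |x| = d(o,x) = length x.\<close>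

fun reduced :: "nat list \<Rightarrow> bool" where
  "reduced [] = True"
| "reduced [a] = True"
| "reduced (a # b # xs) = (a \<noteq> b \<and> reduced (b # xs))"

definition verts :: "nat \<Rightarrow> nat list set" where
  "verts q = {x. set x \<subseteq> {..q} \<and> reduced x}"

fun lcp :: "nat list \<Rightarrow> nat list \<Rightarrow> nat" where
  "lcp (a # xs) (b # ys) = (if a = b then Suc (lcp xs ys) else 0)"
| "lcp _ _ = 0"

definition tdist :: "nat list \<Rightarrow> nat list \<Rightarrow> nat" where
  "tdist x y = length x + length y - 2 * lcp x y"

definition sphere_t :: "nat \<Rightarrow> nat \<Rightarrow> nat list set" where
  "sphere_t q n = {y \<in> verts q. length y = n}"

text \<open>phi_z(x) = int_Omega q^((1/2+iz) h_omega(x)) d nu(omega). For |x| = n the integrand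
depends only on the vertex y = omega_n of the ray at distance n, through
h_omega(x) = 2 lcp(x,y) - n, and nu gives each such cylinder set mass
1/#(sphere of radius n). Hence the integral is the following finite average.\<close>

definition horo :: "nat list \<Rightarrow> nat list \<Rightarrow> int" where
  "horo y x = 2 * int (lcp x y) - int (length x)"

definition qpow :: "nat \<Rightarrow> complex \<Rightarrow> complex" where
  "qpow q w = exp (w * of_real (ln (real q)))"

definition sph :: "nat \<Rightarrow> complex \<Rightarrow> nat list \<Rightarrow> complex" where
  "sph q z x = (\<Sum>y\<in>sphere_t q (length x). qpow q ((1/2 + \<i> * z) * of_int (horo y x)))
               / of_nat (card (sphere_t q (length x)))"

definition tau :: "nat \<Rightarrow> real" where
  "tau q = 2 * pi / ln (real q)"

definition delta :: "real \<Rightarrow> real" where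
  "delta p = 1 / p - 1 / 2"

definition strip :: "real \<Rightarrow> complex set" where
  "strip p = {z. \<bar>Im z\<bar> \<le> \<bar>delta p\<bar>}"

definition nu_sn :: "nat \<Rightarrow> real \<Rightarrow> nat \<Rightarrow> (nat list \<Rightarrow> complex) \<Rightarrow> real" where
  "nu_sn q p m f = (SUP x\<in>verts q. (1 + real (length x)) ^ m * real q powr (real (length x) / p) * cmod (f x))"

definition radial :: "nat \<Rightarrow> (nat list \<Rightarrow> complex) \<Rightarrow> bool" where
  "radial q f \<longleftrightarrow> (\<forall>x\<in>verts q. \<forall>y\<in>verts q. length x = length y \<longrightarrow> f x = f y)"

definition Sp_space :: "nat \<Rightarrow> real \<Rightarrow> (nat list \<Rightarrow> complex) set" where
  "Sp_space q p = {f. (\<forall>x. x \<notin> verts q \<longrightarrow> f x = 0) \<and>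
     (\<forall>m. bdd_above ((\<lambda>x. (1 + real (length x)) ^ m * real q powr (real (length x) / p) * cmod (f x)) ` verts q))}"

definition Sp_rad :: "nat \<Rightarrow> real \<Rightarrow> (nat list \<Rightarrow> complex) set" where
  "Sp_rad q p = {f \<in> Sp_space q p. radial q f}"

text \<open>Complex derivative within a set, and its iterates (g^(m) on S_p; on the boundary
lines, resp. on S_2 = R, this is the derivative within S_p).\<close>

definition cderiv_within :: "complex set \<Rightarrow> (complex \<Rightarrow> complex) \<Rightarrow> complex \<Rightarrow> complex" where
  "cderiv_within S g z = (THE d. (g has_field_derivative d) (at z within S))"

fun cdiff :: "complex set \<Rightarrow> nat \<Rightarrow> (complex \<Rightarrow> complex) \<Rightarrow> complex \<Rightarrow> complex" where
  "cdiff S 0 g = g"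
| "cdiff S (Suc m) g = cderiv_within S (cdiff S m g)"

definition mu_sn :: "real \<Rightarrow> nat \<Rightarrow> (complex \<Rightarrow> complex) \<Rightarrow> real" where
  "mu_sn p m g = (SUP z\<in>strip p. cmod (cdiff (strip p) m g z))"

definition H_rad :: "nat \<Rightarrow> real \<Rightarrow> (complex \<Rightarrow> complex) set" where
  "H_rad q p = {g. (\<forall>z. z \<notin> strip p \<longrightarrow> g z = 0)
     \<and> (\<forall>z\<in>strip p. g (- z) = g z)
     \<and> (\<forall>z\<in>strip p. g (z + of_real (tau q)) = g z)
     \<and> g holomorphic_on interior (strip p)
     \<and> continuous_on (strip p) g
     \<and> (\<forall>m. \<forall>z\<in>strip p. (cdiff (strip p) m g has_field_derivative cdiff (strip p) (Suc m) g z) (at z within strip p))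
     \<and> (\<forall>m. bdd_above ((\<lambda>z. cmod (cdiff (strip p) m g z)) ` strip p))}"

definition seminorm_topology :: "('a \<Rightarrow> complex) set \<Rightarrow> (nat \<Rightarrow> ('a \<Rightarrow> complex) \<Rightarrow> real) \<Rightarrow> ('a \<Rightarrow> complex) topology" where
  "seminorm_topology V N = topology (\<lambda>U. U \<subseteq> V \<and>
     (\<forall>f\<in>U. \<exists>m. \<exists>\<epsilon>>0. {g\<in>V. \<forall>k\<le>m. N k (g - f) < \<epsilon>} \<subseteq> U))"

definition sft :: "nat \<Rightarrow> real \<Rightarrow> (nat list \<Rightarrow> complex) \<Rightarrow> complex \<Rightarrow> complex" where
  "sft q p f z = (if z \<in> strip p then infsum (\<lambda>x. f x * sph q z x) (verts q) else 0)"

end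

theory Submission
  imports Defs
begin

text \<open>Put $w = q^{iz}$ and, for a radial $f$ with value $F(n)$ on the sphere of radius $n$,
$G(n) = q^{n/2} F(n)$. Counting the vertices of a sphere by the length of their common prefix with
a fixed vertex gives
\[ \hat f(z) = G(0) + \sum_{n\ge1} G(n)\Bigl(w^n + w^{-n} + (1-1/q)\sum_{0<l<n} w^{2l-n}\Bigr). \]
The Schwartz seminorms say that $G(n) q^{|\delta_p| n}$ decays rapidly, so the series may be
differentiated termwise up to the boundary of the strip. The Fourier coefficients $a_k$ of $\hat f$
on the real line satisfy $a_k - a_{k+2} = G(k) - G(k+2)/q$ for $k \ge 0$, hence
$G(k) = \sum_j q^{-j}(a_{k+2j} - a_{k+2j+2})$. Conversely, for $g$ in the target space one moves
the coefficient integrals to the boundary of the strip and integrates by parts to see that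
$a_k q^{|\delta_p| k}$ decays rapidly; the sequence $G$ defined by this formula then has a transform
with the same Fourier coefficients as $g$, and uniqueness of Fourier coefficients (by
Stone--Weierstrass) on every horizontal line shows that the transform is $g$. All the bounds are
linear in the seminorms, which gives continuity both ways.\<close>

section \<open>Topologies defined by seminorms\<close>

lemma openin_seminorm_topology:
  "openin (seminorm_topology V N) U \<longleftrightarrow>
     U \<subseteq> V \<and> (\<forall>f\<in>U. \<exists>m. \<exists>\<epsilon>>0. {g\<in>V. \<forall>k\<le>m. N k (g - f) < \<epsilon>} \<subseteq> U)"
proof -
  let ?P = "\<lambda>U. U \<subseteq> V \<and> (\<forall>f\<in>U. \<exists>m. \<exists>\<epsilon>>0. {g\<in>V. \<forall>k\<le>m. N k (g - f) < \<epsilon>} \<subseteq> U)"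
  have "istopology ?P"
    unfolding istopology_def
  proof (intro conjI allI impI)
    fix S T assume S: "?P S" and T: "?P T"
    show "S \<inter> T \<subseteq> V" using S by blast
    show "\<forall>f\<in>S \<inter> T. \<exists>m. \<exists>\<epsilon>>0. {g \<in> V. \<forall>k\<le>m. N k (g - f) < \<epsilon>} \<subseteq> S \<inter> T"
    proof
      fix f assume f: "f \<in> S \<inter> T"
      obtain m1 e1 where 1: "e1 > 0" "{g \<in> V. \<forall>k\<le>m1. N k (g - f) < e1} \<subseteq> S"
        using S f by blast
      obtain m2 e2 where 2: "e2 > 0" "{g \<in> V. \<forall>k\<le>m2. N k (g - f) < e2} \<subseteq> T"
        using T f by blast
      have "{g \<in> V. \<forall>k\<le>max m1 m2. N k (g - f) < min e1 e2} \<subseteq> S \<inter> T"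
        using 1(2) 2(2) by fastforce
      moreover have "min e1 e2 > 0" using 1 2 by simp
      ultimately show "\<exists>m. \<exists>\<epsilon>>0. {g \<in> V. \<forall>k\<le>m. N k (g - f) < \<epsilon>} \<subseteq> S \<inter> T" by blast
    qed
  next
    fix \<K> assume K: "\<forall>K\<in>\<K>. ?P K"
    show "\<Union>\<K> \<subseteq> V" using K by blast
    show "\<forall>f\<in>\<Union>\<K>. \<exists>m. \<exists>\<epsilon>>0. {g \<in> V. \<forall>k\<le>m. N k (g - f) < \<epsilon>} \<subseteq> \<Union>\<K>"
    proof
      fix f assume "f \<in> \<Union>\<K>"
      then obtain U where U: "U \<in> \<K>" "f \<in> U" by blast
      then obtain m \<epsilon> where "\<epsilon> > 0" "{g \<in> V. \<forall>k\<le>m. N k (g - f) < \<epsilon>} \<subseteq> U" using K by blast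
      then show "\<exists>m. \<exists>\<epsilon>>0. {g \<in> V. \<forall>k\<le>m. N k (g - f) < \<epsilon>} \<subseteq> \<Union>\<K>" using U by blast
    qed
  qed
  then show ?thesis by (simp add: seminorm_topology_def topology_inverse')
qed

lemma topspace_seminorm_topology [simp]: "topspace (seminorm_topology V N) = V"
proof -
  have "openin (seminorm_topology V N) V"
    unfolding openin_seminorm_topology by (auto intro: exI[of _ 1])
  moreover have "U \<subseteq> V" if "openin (seminorm_topology V N) U" for U
    using that openin_seminorm_topology by blast
  ultimately show ?thesis by (metis openin_subset openin_topspace subset_antisym)
qed

lemma continuous_map_seminorm_topology:
  fixes T :: "('a \<Rightarrow> complex) \<Rightarrow> 'b \<Rightarrow> complex"
  assumes maps: "\<And>f. f \<in> V \<Longrightarrow> T f \<in> W"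
    and diff: "\<And>f g. f \<in> V \<Longrightarrow> g \<in> V \<Longrightarrow> g - f \<in> V"
    and lin: "\<And>f g. f \<in> V \<Longrightarrow> g \<in> V \<Longrightarrow> T (g - f) = T g - T f"
    and bound: "\<And>k. \<exists>C m. C \<ge> 0 \<and> (\<forall>h\<in>V. M k (T h) \<le> C * (\<Sum>j\<le>m. N j h))"
  shows "continuous_map (seminorm_topology V N) (seminorm_topology W M) T"
  unfolding continuous_map_alt topspace_seminorm_topology
proof (intro conjI allI impI)
  show "T \<in> V \<rightarrow> W" using maps by blast
next
  fix U assume U: "openin (seminorm_topology W M) U"
  obtain C m where C: "\<And>k. C k \<ge> 0" and Cm: "\<And>k h. h \<in> V \<Longrightarrow> M k (T h) \<le> C k * (\<Sum>j\<le>m k. N j h)"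
    using bound by metis
  show "openin (seminorm_topology V N) (T -` U \<inter> V)"
    unfolding openin_seminorm_topology
  proof (intro conjI ballI)
    show "T -` U \<inter> V \<subseteq> V" by blast
    fix f assume f: "f \<in> T -` U \<inter> V"
    then obtain n e where e: "e > 0" and n: "{g\<in>W. \<forall>k\<le>n. M k (g - T f) < e} \<subseteq> U"
      using U unfolding openin_seminorm_topology by blast
    define K where "K = (\<Sum>k\<le>n. C k * real (Suc (m k))) + 1"
    have K: "C k * real (Suc (m k)) < K" if "k \<le> n" for k
      using member_le_sum[of k "{..n}" "\<lambda>k. C k * real (Suc (m k))"] C that
      unfolding K_def by fastforce
    have K0: "K > 0" using K[of 0] C[of 0] by (smt (verit) le0 mult_nonneg_nonneg of_nat_0_le_iff)
    have "g \<in> T -` U \<inter> V" if g: "g \<in> V" and small: "\<forall>k\<le>(\<Sum>k\<le>n. m k). N k (g - f) < e / K" for g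
    proof -
      have "M k (T g - T f) < e" if k: "k \<le> n" for k
      proof -
        have mk: "m k \<le> (\<Sum>k\<le>n. m k)" using k member_le_sum[of k "{..n}" m] by simp
        have "(\<Sum>j\<le>m k. N j (g - f)) \<le> (\<Sum>j\<le>m k. e / K)"
          using small mk by (intro sum_mono less_imp_le) auto
        then have "C k * (\<Sum>j\<le>m k. N j (g - f)) \<le> C k * (real (Suc (m k)) * (e / K))"
          using C[of k] by (intro mult_left_mono) auto
        also have "\<dots> = C k * real (Suc (m k)) * (e / K)" by simp
        also have "\<dots> < K * (e / K)"
          using K[OF k] K0 e by (intro mult_strict_right_mono) auto
        also have "\<dots> = e" using K0 by simp
        finally have "C k * (\<Sum>j\<le>m k. N j (g - f)) < e" .
        moreover have "M k (T g - T f) \<le> C k * (\<Sum>j\<le>m k. N j (g - f))"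
          using Cm[OF diff, of f g k] f g lin by simp
        ultimately show ?thesis by linarith
      qed
      then show ?thesis using n maps[OF g] g by blast
    qed
    then show "\<exists>m. \<exists>\<epsilon>>0. {g \<in> V. \<forall>k\<le>m. N k (g - f) < \<epsilon>} \<subseteq> T -` U \<inter> V"
      by (intro exI[of _ "\<Sum>k\<le>n. m k"] exI[of _ "e / K"]) (use e K0 in auto)
  qed
qed

section \<open>Counting vertices by common prefixes\<close>

definition words :: "nat \<Rightarrow> nat \<Rightarrow> nat \<Rightarrow> nat list set" where
  "words q c n = {y. set y \<subseteq> {..q} \<and> reduced (c # y) \<and> length y = n}"

lemma words_0: "words q c 0 = {[]}"
  by (auto simp: words_def)

lemma words_Suc: "words q c (Suc n) = (\<Union>b\<in>{..q} - {c}. (#) b ` words q b n)"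
  by (auto simp: words_def length_Suc_conv image_iff)

lemma sphere_t_Suc: "sphere_t q (Suc n) = (\<Union>b\<in>{..q}. (#) b ` words q b n)"
  by (auto simp: words_def sphere_t_def verts_def length_Suc_conv image_iff)

lemma sphere_t_0: "sphere_t q 0 = {[]}"
  by (auto simp: sphere_t_def verts_def)

lemma finite_words [simp]: "finite (words q c n)"
  by (induction n arbitrary: c) (auto simp: words_0 words_Suc)

lemma finite_sphere_t [simp]: "finite (sphere_t q n)"
  by (cases n) (auto simp: sphere_t_0 sphere_t_Suc)

lemma sum_UN_Cons:
  assumes "finite B"
  shows "(\<Sum>y\<in>(\<Union>b\<in>B. (#) b ` words q b n). g y) = (\<Sum>b\<in>B. \<Sum>y\<in>words q b n. g (b # y))"
  by (subst sum.UNION_disjoint) (use assms in \<open>auto simp: sum.reindex\<close>)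

lemma card_words: "c \<le> q \<Longrightarrow> card (words q c n) = q ^ n"
proof (induction n arbitrary: c)
  case (Suc n)
  have "card (words q c (Suc n)) = (\<Sum>b\<in>{..q} - {c}. \<Sum>y\<in>words q b n. 1)"
    unfolding card_eq_sum words_Suc by (subst sum_UN_Cons) auto
  also have "\<dots> = (\<Sum>b\<in>{..q} - {c}. q ^ n)"
    by (intro sum.cong) (auto simp: Suc.IH)
  also have "\<dots> = q ^ Suc n" using Suc.prems by simp
  finally show ?case .
qed (simp add: words_0)

lemma card_sphere_t_Suc: "card (sphere_t q (Suc n)) = (q + 1) * q ^ n"
proof -
  have "card (sphere_t q (Suc n)) = (\<Sum>b\<in>{..q}. \<Sum>y\<in>words q b n. 1)"
    unfolding card_eq_sum sphere_t_Suc by (subst sum_UN_Cons) auto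
  also have "\<dots> = (\<Sum>b\<in>{..q}. q ^ n)"
    by (intro sum.cong) (auto simp: card_words)
  finally show ?thesis by simp
qed

lemma sum_words_lcp:
  fixes g :: "nat \<Rightarrow> complex"
  assumes "x \<in> words q c n" "c \<le> q" "1 \<le> q"
  shows "(\<Sum>y\<in>words q c n. g (lcp x y)) =
         g n + (\<Sum>l<n. (of_nat q - 1) * of_nat q ^ (n - l - 1) * g l)"
  using assms
proof (induction n arbitrary: x c g)
  case 0
  then show ?case by (simp add: words_0)
next
  case (Suc n)
  obtain b x' where x: "x = b # x'" "b \<le> q" "b \<noteq> c" "x' \<in> words q b n"
    using Suc.prems(1) unfolding words_Suc by auto
  have "(\<Sum>y\<in>words q c (Suc n). g (lcp x y)) =
        (\<Sum>b'\<in>{..q} - {c}. \<Sum>y\<in>words q b' n. g (lcp x (b' # y)))"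
    unfolding words_Suc by (subst sum_UN_Cons) auto
  also have "\<dots> = (\<Sum>y\<in>words q b n. g (lcp x (b # y))) +
        (\<Sum>b'\<in>{..q} - {c} - {b}. \<Sum>y\<in>words q b' n. g (lcp x (b' # y)))"
    using x by (intro sum.remove) auto
  also have "(\<Sum>y\<in>words q b n. g (lcp x (b # y))) = (\<Sum>y\<in>words q b n. (g \<circ> Suc) (lcp x' y))"
    by (simp add: x)
  also have "\<dots> = g (Suc n) + (\<Sum>l<n. (of_nat q - 1) * of_nat q ^ (n - l - 1) * g (Suc l))"
    using Suc.IH[OF x(4,2) Suc.prems(3), of "g \<circ> Suc"] by simp
  also have "(\<Sum>b'\<in>{..q} - {c} - {b}. \<Sum>y\<in>words q b' n. g (lcp x (b' # y))) =
             (\<Sum>b'\<in>{..q} - {c} - {b}. of_nat q ^ n * g 0)"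
    by (intro sum.cong) (auto simp: x card_words)
  also have "\<dots> = (of_nat q - 1) * of_nat q ^ n * g 0"
    using Suc.prems x by (simp add: of_nat_diff)
  finally show ?case unfolding sum.lessThan_Suc_shift by simp
qed

lemma sum_sphere_t_lcp:
  fixes g :: "nat \<Rightarrow> complex"
  assumes "x \<in> sphere_t q (Suc n)" "1 \<le> q"
  shows "(\<Sum>y\<in>sphere_t q (Suc n). g (lcp x y)) =
     of_nat q ^ Suc n * g 0 + (\<Sum>l<n. (of_nat q - 1) * of_nat q ^ (n - l - 1) * g (Suc l)) + g (Suc n)"
proof -
  obtain b x' where x: "x = b # x'" "b \<le> q" "x' \<in> words q b n"
    using assms(1) unfolding sphere_t_Suc by auto
  have "(\<Sum>y\<in>sphere_t q (Suc n). g (lcp x y)) =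
        (\<Sum>b'\<in>{..q}. \<Sum>y\<in>words q b' n. g (lcp x (b' # y)))"
    unfolding sphere_t_Suc by (subst sum_UN_Cons) auto
  also have "\<dots> = (\<Sum>y\<in>words q b n. g (lcp x (b # y))) +
        (\<Sum>b'\<in>{..q} - {b}. \<Sum>y\<in>words q b' n. g (lcp x (b' # y)))"
    using x by (intro sum.remove) auto
  also have "(\<Sum>y\<in>words q b n. g (lcp x (b # y))) = (\<Sum>y\<in>words q b n. (g \<circ> Suc) (lcp x' y))"
    by (simp add: x)
  also have "\<dots> = g (Suc n) + (\<Sum>l<n. (of_nat q - 1) * of_nat q ^ (n - l - 1) * g (Suc l))"
    using sum_words_lcp[OF x(3,2) assms(2), of "g \<circ> Suc"] by simp
  also have "(\<Sum>b'\<in>{..q} - {b}. \<Sum>y\<in>words q b' n. g (lcp x (b' # y))) =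
             (\<Sum>b'\<in>{..q} - {b}. of_nat q ^ n * g 0)"
    by (intro sum.cong) (auto simp: x card_words)
  also have "\<dots> = of_nat q ^ Suc n * g 0"
    using x by simp
  finally show ?thesis by simp
qed

section \<open>Uniqueness of Fourier coefficients\<close>

lemma polynomial_multiplier_annihilates:
  fixes h :: "real \<Rightarrow> complex" and \<phi> :: "complex \<Rightarrow> real"
  assumes "real_polynomial_function \<phi>"
    and "continuous_on {0..T} h"
    and "\<And>k::int. integral {0..T} (\<lambda>t. h t * cis (of_int k * (L * t))) = 0"
  shows "continuous_on {0..T} (\<lambda>t. h t * of_real (\<phi> (cis (L * t)))) \<and>
    (\<forall>k::int. integral {0..T} (\<lambda>t. h t * of_real (\<phi> (cis (L * t))) * cis (of_int k * (L * t))) = 0)"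
  using assms
proof (induction \<phi> arbitrary: h rule: real_polynomial_function.induct)
  case (linear \<phi>)
  note h = linear.prems
  interpret bounded_linear \<phi> by fact
  define c1 c2 where "c1 = Complex (\<phi> 1 / 2) (- \<phi> \<i> / 2)" and "c2 = Complex (\<phi> 1 / 2) (\<phi> \<i> / 2)"
  have eq: "complex_of_real (\<phi> (cis s)) = c1 * cis s + c2 * cis (- s)" for s
  proof -
    have "cis s = cos s *\<^sub>R 1 + sin s *\<^sub>R \<i>" by (simp add: complex_eq_iff)
    then have "\<phi> (cis s) = cos s * \<phi> 1 + sin s * \<phi> \<i>" by (simp add: add scaleR)
    then show ?thesis by (simp add: complex_eq_iff c1_def c2_def field_simps)
  qed
  have c: "continuous_on {0..T} (\<lambda>t. h t * cis (of_int k * (L * t)))" for k :: int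
    unfolding cis_conv_exp by (intro continuous_intros h)
  have hi: "((\<lambda>t. h t * cis (of_int k * (L * t))) has_integral 0) {0..T}" for k :: int
    using integrable_integral[OF integrable_continuous_real[OF c]] h(2) by metis
  have e: "h t * of_real (\<phi> (cis (L * t))) * cis (of_int k * (L * t)) =
       c1 * (h t * cis (of_int (k + 1) * (L * t))) + c2 * (h t * cis (of_int (k - 1) * (L * t)))" for t k
  proof -
    have "cis (of_int (k + 1) * (L * t)) = cis (L * t) * cis (of_int k * (L * t))"
         "cis (of_int (k - 1) * (L * t)) = cis (- (L * t)) * cis (of_int k * (L * t))"
      by (simp_all add: cis_mult algebra_simps)
    then show ?thesis unfolding eq by (simp only: ring_distribs mult_ac)
  qed
  have "integral {0..T} (\<lambda>t. h t * of_real (\<phi> (cis (L * t))) * cis (of_int k * (L * t))) = 0" for k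
    unfolding e
    using has_integral_add[OF has_integral_mult_right[OF hi[of "k + 1"], of c1]
        has_integral_mult_right[OF hi[of "k - 1"], of c2]]
    by (simp add: integral_unique)
  moreover have "continuous_on {0..T} (\<lambda>t. h t * (c1 * cis (L * t) + c2 * cis (- (L * t))))"
    unfolding cis_conv_exp by (intro continuous_intros h)
  ultimately show ?case by (simp only: eq simp_thms)
next
  case (const c)
  have "((\<lambda>t. h t * cis (of_int k * (L * t)) * of_real c) has_integral 0) {0..T}" for k :: int
  proof -
    have "continuous_on {0..T} (\<lambda>t. h t * cis (of_int k * (L * t)))"
      unfolding cis_conv_exp by (intro continuous_intros const)
    then have "((\<lambda>t. h t * cis (of_int k * (L * t))) has_integral 0) {0..T}"
      using integrable_integral[OF integrable_continuous_real] const(2) by metis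
    from has_integral_mult_left[OF this, of "of_real c"] show ?thesis by simp
  qed
  then show ?case using const by (auto intro!: continuous_intros integral_unique simp: mult_ac)
next
  case (add f g)
  note A = add.IH(1)[OF add.prems] and B = add.IH(2)[OF add.prems]
  have "integral {0..T} (\<lambda>t. h t * of_real (f (cis (L * t))) * cis (of_int k * (L * t)) +
          h t * of_real (g (cis (L * t))) * cis (of_int k * (L * t))) = 0" for k :: int
    by (subst integral_add) (use A B in \<open>auto simp: cis_conv_exp intro!: integrable_continuous_real continuous_intros\<close>)
  then show ?case using A B by (auto simp: algebra_simps intro!: continuous_on_add)
next
  case (mult f g)
  note A = mult.IH(1)[OF mult.prems]
  show ?case using mult.IH(2)[of "\<lambda>t. h t * of_real (f (cis (L * t)))"] A by (simp add: mult.assoc)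
qed

lemma Fourier_coefficients_zero_imp_zero:
  fixes h :: "real \<Rightarrow> complex"
  assumes L: "L > 0" and T: "T = 2 * pi / L"
    and cont: "continuous_on {0..T} h" and per: "h 0 = h T"
    and zero: "\<And>k::int. integral {0..T} (\<lambda>t. h t * cis (of_int k * (L * t))) = 0"
    and t: "t \<in> {0..T}"
  shows "h t = 0"
proof -
  have T0: "T > 0" using L T by simp
  define e where "e = (\<lambda>t. cis (L * t))"
  have LT: "L * T = 2 * pi" using L T by simp
  have econt: "continuous_on {0..T} e"
    unfolding e_def cis_conv_exp by (intro continuous_intros)
  have esurj: "e ` {0..T} = sphere 0 1"
  proof (intro set_eqI iffI)
    fix w :: complex assume "w \<in> sphere 0 1"
    then have "cmod w = 1" by simp
    then obtain s where s: "0 \<le> s" "s < 2 * pi" "w = cis s"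
      using Arg2pi[of w] unfolding is_Arg_def cis_conv_exp by (metis mult_1 of_real_1)
    then have "e (s / L) = w" "s / L \<in> {0..T}"
      using L T by (auto simp: e_def divide_le_cancel)
    then show "w \<in> e ` {0..T}" by blast
  qed (auto simp: e_def)
  have einj: "h s = h s'" if "s \<in> {0..T}" "s' \<in> {0..T}" "e s = e s'" for s s'
  proof -
    have "s = s'" if "\<bar>s - s'\<bar> < T"
    proof -
      have "\<bar>L * s - L * s'\<bar> = L * \<bar>s - s'\<bar>" using L by (simp add: abs_mult flip: right_diff_distrib)
      also have "\<dots> < 2 * pi" using that L T by (simp add: field_simps)
      finally have lt: "\<bar>L * s - L * s'\<bar> < 2 * pi" .
      have "exp (\<i> * of_real (L * s)) = exp (\<i> * of_real (L * s'))"
        using \<open>e s = e s'\<close> by (simp only: e_def cis_conv_exp)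
      then have "\<i> * of_real (L * s) = \<i> * of_real (L * s')"
        by (rule exp_complex_eqI[rotated]) (use lt in simp)
      then have "complex_of_real (L * s) = of_real (L * s')" by (metis complex_i_not_zero mult_left_cancel)
      then show ?thesis using L of_real_eq_iff mult_left_cancel by (metis less_irrefl)
    qed
    moreover have "s = 0 \<and> s' = T \<or> s = T \<and> s' = 0" if "\<not> \<bar>s - s'\<bar> < T"
      using that \<open>s \<in> {0..T}\<close> \<open>s' \<in> {0..T}\<close> by auto
    ultimately show ?thesis using per by metis
  qed
  have "quotient_map (top_of_set {0..T}) (top_of_set (sphere 0 1)) e"
    using econt esurj by (intro continuous_imp_quotient_map) (auto simp: compact_space_subtopology Hausdorff_space_subtopology)
  moreover have "continuous_map (top_of_set {0..T}) euclidean h" using cont by simp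
  moreover have "h s = h s'" if "s \<in> topspace (top_of_set {0..T})" "s' \<in> topspace (top_of_set {0..T})" "e s = e s'" for s s'
    by (rule einj) (use that in simp_all)
  ultimately obtain F where F: "continuous_map (top_of_set (sphere 0 1)) euclidean F"
      and "F ` topspace (top_of_set (sphere 0 1)) = h ` topspace (top_of_set {0..T})"
      and "\<And>s. s \<in> topspace (top_of_set {0..T}) \<Longrightarrow> F (e s) = h s"
    by (rule quotient_map_lift_exists) blast+
  then have Fe: "\<And>s. s \<in> {0..T} \<Longrightarrow> F (e s) = h s" by (simp only: topspace_euclidean_subtopology)
  have Fcont: "continuous_on (sphere 0 1) F" using F by simp
  obtain B where B: "\<And>s. s \<in> {0..T} \<Longrightarrow> cmod (h s) \<le> B"
    using compact_continuous_image[OF cont] compact_imp_bounded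
    by (metis bounded_iff compact_Icc imageI)
  have B0: "B \<ge> 0" using order_trans[OF norm_ge_zero B[of 0]] T0 by simp
  have hh: "(\<lambda>t. h t * cnj (h t)) integrable_on {0..T}"
    by (intro integrable_continuous_real continuous_intros cont)
  have small: "cmod (integral {0..T} (\<lambda>t. h t * cnj (h t))) \<le> B * \<epsilon> * T" if "\<epsilon> > 0" for \<epsilon>
  proof -
    have "\<exists>g. polynomial_function g \<and> (\<forall>x\<in>sphere 0 1. norm (cnj (F x) - g x) < \<epsilon>)"
      using that by (intro Stone_Weierstrass_polynomial_function continuous_intros Fcont) auto
    then obtain g where g: "polynomial_function g"
      and gF: "\<And>x. x \<in> sphere 0 1 \<Longrightarrow> norm (cnj (F x) - g x) < \<epsilon>" by blast
    have "real_polynomial_function (\<lambda>x. Re (g x))" "real_polynomial_function (\<lambda>x. Im (g x))"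
      using g bounded_linear_Re bounded_linear_Im unfolding polynomial_function_def comp_def by blast+
    note P = this[THEN polynomial_multiplier_annihilates, OF cont zero]
    have "((\<lambda>t. h t * of_real (Re (g (cis (L * t))))) has_integral 0) {0..T}"
         "((\<lambda>t. h t * of_real (Im (g (cis (L * t))))) has_integral 0) {0..T}"
      using P[THEN conjunct1, THEN integrable_continuous_real, THEN integrable_integral]
        P[THEN conjunct2, THEN spec, of 0] by simp_all
    from has_integral_add[OF this(1) has_integral_mult_right[OF this(2), of \<i>]]
    have "((\<lambda>t. h t * g (cis (L * t))) has_integral 0) {0..T}"
      by (rule has_integral_eq[rotated, THEN has_integral_eq_rhs]) (auto simp: complex_eq_iff algebra_simps)
    from has_integral_diff[OF integrable_integral[OF hh] this]
    have "((\<lambda>t. h t * (cnj (h t) - g (cis (L * t)))) has_integral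
        integral {0..T} (\<lambda>t. h t * cnj (h t))) {0..T}"
      by (simp add: right_diff_distrib)
    moreover have "cmod (h s * (cnj (h s) - g (cis (L * s)))) \<le> B * \<epsilon>" if "s \<in> {0..T}" for s
    proof -
      have "cis (L * s) \<in> sphere 0 1" by simp
      then have "cmod (cnj (h s) - g (cis (L * s))) \<le> \<epsilon>"
        using gF Fe[OF that] unfolding e_def by (metis less_imp_le)
      then show ?thesis unfolding norm_mult using B[OF that] B0 by (intro mult_mono) auto
    qed
    ultimately show ?thesis
      using has_integral_bound_real[of "B * \<epsilon>" "{}" "\<lambda>t. h t * (cnj (h t) - g (cis (L * t)))" _ 0 T] B0 T0 that
      by simp
  qed
  have "integral {0..T} (\<lambda>t. h t * cnj (h t)) = 0"
  proof (rule ccontr)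
    assume "\<not> ?thesis"
    then have *: "cmod (integral {0..T} (\<lambda>t. h t * cnj (h t))) > 0" (is "?I > 0") by simp
    have "?I \<le> B * (?I / (2 * (B + 1) * T)) * T"
      using * B0 T0 by (intro small) auto
    also have "\<dots> = ?I * (B / (2 * (B + 1)))" using T0 by simp
    also have "\<dots> < ?I * 1"
      using * B0 by (intro mult_strict_left_mono) (auto simp: field_simps)
    finally show False by simp
  qed
  moreover have "(\<lambda>t. h t * cnj (h t)) = (\<lambda>t. complex_of_real ((cmod (h t))\<^sup>2))"
    by (simp only: complex_norm_square)
  ultimately have "((\<lambda>t. complex_of_real ((cmod (h t))\<^sup>2)) has_integral 0) {0..T}"
    using hh integrable_integral by metis
  from has_integral_Re[OF this] have "((\<lambda>t. (cmod (h t))\<^sup>2) has_integral 0) (cbox 0 T)" by simp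
  moreover have "continuous_on (cbox 0 T) (\<lambda>t. (cmod (h t))\<^sup>2)"
    using cont by (auto intro!: continuous_intros)
  ultimately have "(cmod (h t))\<^sup>2 = 0"
    using has_integral_0_cbox_imp_0[of 0 T "\<lambda>t. (cmod (h t))\<^sup>2" t] t T0 by simp
  then show ?thesis by simp
qed

section \<open>Smooth periodic functions on the strip\<close>

declare cdiff.simps(2) [simp del]

lemma has_field_derivative_within_unique:
  assumes "(f has_field_derivative a) (at z within S)" "(f has_field_derivative b) (at z within S)"
    and "at z within S \<noteq> bot"
  shows "a = b"
  using assms tendsto_unique unfolding has_field_derivative_iff by blast

locale tree_strip =
  fixes q :: nat and p :: real
  assumes q2: "2 \<le> q" and p1: "1 < p" and p2: "p \<le> 2"
begin

abbreviation "L \<equiv> ln (real q)"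
abbreviation "d \<equiv> delta p"
abbreviation "T \<equiv> tau q"
abbreviation "S \<equiv> strip p"

lemma L_pos: "L > 0" using q2 by simp

lemma d_nonneg: "d \<ge> 0" using p1 p2 by (simp add: delta_def field_simps)

lemma T_pos: "T > 0" using L_pos by (simp add: tau_def)

lemma LT: "L * T = 2 * pi" using L_pos by (simp add: tau_def)

lemma in_strip_iff: "z \<in> S \<longleftrightarrow> \<bar>Im z\<bar> \<le> d"
  using d_nonneg by (simp add: strip_def)

lemma convex_strip: "convex S"
proof -
  have "S = {z. Im z \<le> d} \<inter> {z. Im z \<ge> - d}" by (auto simp: in_strip_iff)
  then show ?thesis by (simp add: convex_Int convex_halfspace_Im_le convex_halfspace_Im_ge)
qed

lemma at_within_strip:
  assumes "z \<in> S" shows "at z within S \<noteq> bot"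
proof -
  have "\<exists>w\<in>S. w \<noteq> z \<and> dist w z < e" if "e > 0" for e
    using that assms by (intro bexI[of _ "z + of_real (e / 2)"]) (auto simp: in_strip_iff dist_norm)
  then show ?thesis by (simp add: trivial_limit_within islimpt_approachable)
qed

lemma strip_deriv_unique:
  "(f has_field_derivative a) (at z within S) \<Longrightarrow> (f has_field_derivative b) (at z within S) \<Longrightarrow> z \<in> S \<Longrightarrow> a = b"
  using has_field_derivative_within_unique at_within_strip by blast

lemma strip_deriv_cong:
  assumes "(f has_field_derivative a) (at z within S)" "z \<in> S" "\<And>w. w \<in> S \<Longrightarrow> g w = f w"
  shows "(g has_field_derivative a) (at z within S)"
  using has_field_derivative_transform_within[OF assms(1), of 1 g] assms by simp

lemma cdiff_eq:
  assumes "\<And>m z. z \<in> S \<Longrightarrow> (D m has_field_derivative D (Suc m) z) (at z within S)"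
    and "\<And>z. z \<in> S \<Longrightarrow> g z = D 0 z"
  shows "z \<in> S \<Longrightarrow> cdiff S m g z = D m z"
proof (induction m arbitrary: z)
  case (Suc m)
  have "(cdiff S m g has_field_derivative D (Suc m) z) (at z within S)"
    by (rule strip_deriv_cong[OF assms(1)[OF Suc.prems] Suc.prems Suc.IH])
  then show ?case
    using strip_deriv_unique Suc.prems by (auto simp: cdiff.simps(2) cderiv_within_def)
qed (use assms in simp)

lemma H_rad_memI:
  assumes D: "\<And>m z. z \<in> S \<Longrightarrow> (D m has_field_derivative D (Suc m) z) (at z within S)"
    and g: "\<And>z. z \<in> S \<Longrightarrow> g z = D 0 z" and out: "\<And>z. z \<notin> S \<Longrightarrow> g z = 0"
    and even: "\<And>z. z \<in> S \<Longrightarrow> g (- z) = g z" and per: "\<And>z. z \<in> S \<Longrightarrow> g (z + of_real T) = g z"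
    and bdd: "\<And>m. bdd_above ((\<lambda>z. cmod (D m z)) ` S)"
  shows "g \<in> H_rad q p"
proof -
  have c: "cdiff S m g z = D m z" if "z \<in> S" for m z
    using cdiff_eq[of D g] D g that by blast
  have d: "(cdiff S m g has_field_derivative cdiff S (Suc m) g z) (at z within S)" if "z \<in> S" for m z
    using strip_deriv_cong[OF D[OF that] that c] c[OF that] by metis
  have d0: "(g has_field_derivative cdiff S 1 g z) (at z within S)" if "z \<in> S" for z
    using d[OF that, of 0] by simp
  have "g holomorphic_on interior S"
    unfolding holomorphic_on_def field_differentiable_def
    using d0 interior_subset has_field_derivative_subset by blast
  moreover have "continuous_on S g"
    using d0 continuous_on_eq_continuous_within DERIV_continuous by blast
  moreover have "bdd_above ((\<lambda>z. cmod (cdiff S m g z)) ` S)" for m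
    using bdd[of m] c by (simp cong: image_cong)
  ultimately show ?thesis
    unfolding H_rad_def using out even per d by blast
qed

definition E :: "int \<Rightarrow> complex \<Rightarrow> complex" where
  "E k z = exp (\<i> * of_int k * of_real L * z)"

lemma E_add: "E (j + k) z = E j z * E k z"
  by (simp add: E_def algebra_simps exp_add)

lemma E_uminus: "E k (- z) = E (- k) z" by (simp add: E_def)

lemma E_nonzero [simp]: "E k z \<noteq> 0" by (simp add: E_def)

lemma E_shift: "E k (z + w) = E k z * E k w"
  by (simp add: E_def algebra_simps exp_add)

lemma E_T [simp]: "E k (of_real T) = 1"
proof -
  have "\<i> * of_int k * of_real L * of_real T = \<i> * of_int k * of_real (L * T)"
    by (simp only: of_real_mult mult_ac)
  also have "\<dots> = 2 * of_int k * of_real pi * \<i>" unfolding LT by simp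
  finally show ?thesis unfolding E_def by (simp only: exp_integer_2pi Ints_of_int) (use exp_integer_2pi[of "of_int k"] in \<open>simp add: mult_ac\<close>)
qed

lemma E_periodic: "E k (z + of_real T) = E k z"
  by (simp add: E_shift)

lemma E_of_real: "E k (of_real t) = cis (of_int k * (L * t))"
  by (simp add: E_def cis_conv_exp mult_ac)

lemma E_has_field_derivative: "(E k has_field_derivative \<i> * of_int k * of_real L * E k z) (at z within A)"
  unfolding E_def by (auto intro!: derivative_eq_intros)

lemma continuous_on_E [continuous_intros]:
  "continuous_on A f \<Longrightarrow> continuous_on A (\<lambda>x. E k (f x))"
  unfolding E_def by (intro continuous_intros)

lemma cmod_E: "cmod (E k z) = real q powr (- (of_int k * Im z))"
  using q2 by (simp add: E_def powr_def)

lemma cmod_E_le: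
  assumes "z \<in> S" "\<bar>k\<bar> \<le> int n" shows "cmod (E k z) \<le> real q powr (d * real n)"
proof -
  have "- (of_int k * Im z) \<le> \<bar>of_int k\<bar> * \<bar>Im z\<bar>" by (metis abs_ge_self abs_minus_cancel abs_mult)
  also have "\<dots> \<le> real n * d"
    using assms by (intro mult_mono) (auto simp: in_strip_iff)
  finally show ?thesis unfolding cmod_E using q2 by (intro powr_mono) (auto simp: mult.commute)
qed

definition line_int :: "real \<Rightarrow> (complex \<Rightarrow> complex) \<Rightarrow> complex" where
  "line_int y H = integral {0..T} (\<lambda>t. H (of_real t + \<i> * of_real y))"

lemma line_in_strip: "\<bar>y\<bar> \<le> d \<Longrightarrow> of_real t + \<i> * of_real y \<in> S"
  by (simp add: in_strip_iff)

lemma continuous_on_line: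
  assumes "continuous_on S H" "\<bar>y\<bar> \<le> d"
  shows "continuous_on A (\<lambda>t. H (of_real t + \<i> * of_real y))"
  by (rule continuous_on_compose2[OF assms(1)]) (use assms(2) in \<open>auto intro!: continuous_intros line_in_strip\<close>)

lemma line_int_derivative:
  assumes H: "\<And>z. z \<in> S \<Longrightarrow> (H has_field_derivative H' z) (at z within S)"
    and per: "\<And>z. z \<in> S \<Longrightarrow> H (z + of_real T) = H z" and y: "\<bar>y\<bar> \<le> d"
  shows "line_int y H' = 0"
proof -
  have "((\<lambda>t. H' (of_real t + \<i> * of_real y)) has_integral
      H (of_real T + \<i> * of_real y) - H (of_real 0 + \<i> * of_real y)) {0..T}"
  proof (rule fundamental_theorem_of_calculus)
    fix t :: real
    let ?l = "\<lambda>t. of_real t + \<i> * complex_of_real y"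
    have "(?l has_vector_derivative 1) (at t within {0..T})"
      by (auto intro!: derivative_eq_intros simp: has_vector_derivative_def scaleR_conv_of_real)
    moreover have "(H has_field_derivative H' (?l t)) (at (?l t) within ?l ` {0..T})"
      using H[OF line_in_strip[OF y]] by (rule has_field_derivative_subset) (use y line_in_strip in blast)
    ultimately have "(H \<circ> ?l has_vector_derivative 1 * H' (?l t)) (at t within {0..T})"
      by (rule field_vector_diff_chain_within)
    then show "((\<lambda>t. H (?l t)) has_vector_derivative H' (?l t)) (at t within {0..T})"
      by (simp add: o_def)
  qed (use T_pos in simp)
  moreover have "H (of_real T + \<i> * of_real y) = H (of_real 0 + \<i> * of_real y)"
    using per[OF line_in_strip[OF y, of 0]] by (simp add: add.commute)
  ultimately show ?thesis unfolding line_int_def by (simp add: integral_unique)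
qed

lemma line_int_const:
  assumes H: "\<And>z. z \<in> S \<Longrightarrow> (H has_field_derivative H' z) (at z within S)"
    and cont: "continuous_on S H'"
    and per: "\<And>z. z \<in> S \<Longrightarrow> H (z + of_real T) = H z" and y: "\<bar>y\<bar> \<le> d"
  shows "line_int y H = line_int 0 H"
proof -
  have contH: "continuous_on S H"
    using H continuous_on_eq_continuous_within DERIV_continuous by blast
  have "((\<lambda>y. integral (cbox 0 T) (\<lambda>t. H (of_real t + \<i> * of_real y))) has_vector_derivative
       integral (cbox 0 T) (\<lambda>t. \<i> * H' (of_real t + \<i> * of_real y))) (at y within {-d..d})"
    if y: "y \<in> {-d..d}" for y
  proof (rule leibniz_rule_vector_derivative)
    fix y t :: real assume y: "y \<in> {-d..d}"
    let ?l = "\<lambda>y. of_real t + \<i> * complex_of_real y"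
    have "(?l has_vector_derivative \<i>) (at y within {-d..d})"
      by (auto intro!: derivative_eq_intros simp: has_vector_derivative_def scaleR_conv_of_real)
    moreover have "(H has_field_derivative H' (?l y)) (at (?l y) within ?l ` {-d..d})"
      by (rule has_field_derivative_subset[OF H]) (use y line_in_strip in auto)
    ultimately have "(H \<circ> ?l has_vector_derivative \<i> * H' (?l y)) (at y within {-d..d})"
      by (rule field_vector_diff_chain_within)
    then show "((\<lambda>y. H (?l y)) has_vector_derivative \<i> * H' (?l y)) (at y within {-d..d})"
      by (simp add: o_def)
  next
    fix y assume "y \<in> {-d..d}"
    then show "(\<lambda>t. H (of_real t + \<i> * of_real y)) integrable_on cbox 0 T"
      using continuous_on_line[OF contH] by (auto intro!: integrable_continuous_real)
  next
    have "continuous_on ({-d..d} \<times> cbox 0 T) (\<lambda>x. \<i> * H' (of_real (snd x) + \<i> * of_real (fst x)))"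
      by (intro continuous_intros continuous_on_compose2[OF cont]) (auto intro!: line_in_strip)
    then show "continuous_on ({-d..d} \<times> cbox 0 T) (\<lambda>(y, t). \<i> * H' (of_real t + \<i> * of_real y))"
      by (simp add: case_prod_unfold)
  qed (use y in auto)
  moreover have "integral (cbox 0 T) (\<lambda>t. \<i> * H' (of_real t + \<i> * of_real y)) = 0" if "y \<in> {-d..d}" for y
    using line_int_derivative[OF H per, of y] that by (auto simp: line_int_def)
  ultimately have "((\<lambda>y. line_int y H) has_vector_derivative 0) (at y within {-d..d})" if "y \<in> {-d..d}" for y
    using that by (fastforce simp: line_int_def)
  then obtain c where "\<And>y. y \<in> {-d..d} \<Longrightarrow> line_int y H = c"
    using has_vector_derivative_zero_constant[of "{-d..d}" "\<lambda>y. line_int y H"] by auto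
  then show ?thesis using y d_nonneg by (metis abs_le_iff abs_zero atLeastAtMost_iff minus_le_iff)
qed

lemma H_radD:
  assumes "g \<in> H_rad q p"
  shows H_rad_outside: "z \<notin> S \<Longrightarrow> g z = 0"
    and H_rad_even: "z \<in> S \<Longrightarrow> g (- z) = g z"
    and H_rad_periodic: "z \<in> S \<Longrightarrow> g (z + of_real T) = g z"
    and H_rad_deriv: "z \<in> S \<Longrightarrow> (cdiff S m g has_field_derivative cdiff S (Suc m) g z) (at z within S)"
    and H_rad_bdd: "bdd_above ((\<lambda>z. cmod (cdiff S m g z)) ` S)"
  using assms by (simp_all add: H_rad_def)

lemma H_rad_continuous:
  assumes "g \<in> H_rad q p" shows "continuous_on S (cdiff S m g)"
  using H_rad_deriv[OF assms] continuous_on_eq_continuous_within DERIV_continuous by blast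

lemma cmod_cdiff_le_mu:
  assumes "g \<in> H_rad q p" "z \<in> S" shows "cmod (cdiff S m g z) \<le> mu_sn p m g"
  unfolding mu_sn_def using H_rad_bdd[OF assms(1)] assms(2) by (rule cSUP_upper2) auto

lemma mu_le:
  assumes "\<And>z. z \<in> S \<Longrightarrow> cmod (cdiff S m g z) \<le> B" shows "mu_sn p m g \<le> B"
proof -
  have "0 \<in> S" using d_nonneg by (simp add: in_strip_iff)
  then show ?thesis unfolding mu_sn_def using assms by (intro cSUP_least) auto
qed

lemma strip_shift: "z \<in> S \<Longrightarrow> z + of_real t \<in> S"
  by (simp add: in_strip_iff)

lemma cdiff_periodic:
  assumes g: "g \<in> H_rad q p" shows "z \<in> S \<Longrightarrow> cdiff S m g (z + of_real T) = cdiff S m g z"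
proof (induction m arbitrary: z)
  case (Suc m)
  have "((\<lambda>w. w + of_real T) has_field_derivative 1) (at z within S)"
    by (auto intro!: derivative_eq_intros)
  moreover have "(cdiff S m g has_field_derivative cdiff S (Suc m) g (z + of_real T))
      (at (z + of_real T) within (\<lambda>w. w + of_real T) ` S)"
    using H_rad_deriv[OF g strip_shift[OF Suc.prems]]
    by (rule has_field_derivative_subset) (auto intro: strip_shift)
  ultimately have "((\<lambda>w. cdiff S m g (w + of_real T)) has_field_derivative cdiff S (Suc m) g (z + of_real T)) (at z within S)"
    using DERIV_image_chain[of "cdiff S m g" _ "\<lambda>w. w + of_real T"] by (force simp: o_def)
  then have "(cdiff S m g has_field_derivative cdiff S (Suc m) g (z + of_real T)) (at z within S)"
    by (rule strip_deriv_cong) (use Suc in auto)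
  then show ?case using H_rad_deriv[OF g Suc.prems] strip_deriv_unique Suc.prems by blast
qed (use H_rad_periodic[OF g] in simp)

lemma H_rad_diff:
  assumes f: "f \<in> H_rad q p" and g: "g \<in> H_rad q p"
  shows "(\<lambda>z. g z - f z) \<in> H_rad q p"
proof (rule H_rad_memI[where D = "\<lambda>m z. cdiff S m g z - cdiff S m f z"])
  fix m
  show "bdd_above ((\<lambda>z. cmod (cdiff S m g z - cdiff S m f z)) ` S)"
  proof (rule bdd_aboveI2)
    fix z assume z: "z \<in> S"
    show "cmod (cdiff S m g z - cdiff S m f z) \<le> mu_sn p m g + mu_sn p m f"
      using norm_triangle_ineq4[of "cdiff S m g z" "cdiff S m f z"]
        cmod_cdiff_le_mu[OF g z, of m] cmod_cdiff_le_mu[OF f z, of m] by linarith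
  qed
qed (use f g in \<open>auto simp: H_rad_outside H_rad_even H_rad_periodic
      intro!: DERIV_diff H_rad_deriv, auto?\<close>)

definition coef :: "(complex \<Rightarrow> complex) \<Rightarrow> int \<Rightarrow> complex" where
  "coef g k = line_int 0 (\<lambda>z. g z * E (- k) z) / of_real T"

lemma has_integral_line:
  assumes "continuous_on S H" "\<bar>y\<bar> \<le> d"
  shows "((\<lambda>t. H (of_real t + \<i> * of_real y)) has_integral line_int y H) {0..T}"
  unfolding line_int_def
  by (intro integrable_integral integrable_continuous_real continuous_on_line assms)

lemma line_int_add:
  assumes "continuous_on S H" "continuous_on S K" "\<bar>y\<bar> \<le> d"
  shows "line_int y (\<lambda>z. H z + K z) = line_int y H + line_int y K"
  using has_integral_add[OF assms(1,2)[THEN has_integral_line, OF assms(3)]]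
  unfolding line_int_def by (rule integral_unique)

lemma line_int_cmult:
  assumes "continuous_on S H" "\<bar>y\<bar> \<le> d"
  shows "line_int y (\<lambda>z. c * H z) = c * line_int y H"
  unfolding line_int_def by simp

lemma cmod_line_int_le:
  assumes "continuous_on S H" "\<bar>y\<bar> \<le> d" "\<And>t. cmod (H (of_real t + \<i> * of_real y)) \<le> B"
  shows "cmod (line_int y H) \<le> B * T"
  unfolding line_int_def
  using integral_bound[OF _ continuous_on_line[OF assms(1,2)], of 0 T B] assms(3) T_pos by simp

lemma line_int_coef:
  assumes g: "g \<in> H_rad q p" and y: "\<bar>y\<bar> \<le> d"
  shows "line_int y (\<lambda>z. cdiff S m g z * E (- k) z) = (\<i> * of_int k * of_real L) ^ m * (coef g k * of_real T)"
proof -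
  have c: "continuous_on S (\<lambda>z. cdiff S m g z * E (- k) z)" for m
    by (intro continuous_intros H_rad_continuous g)
  define D where "D m z = cdiff S (Suc m) g z * E (- k) z + (- (\<i> * of_int k * of_real L)) * (cdiff S m g z * E (- k) z)" for m z
  have D: "((\<lambda>z. cdiff S m g z * E (- k) z) has_field_derivative D m z) (at z within S)" if "z \<in> S" for m z
    using DERIV_mult[OF H_rad_deriv[OF g that, of m] E_has_field_derivative[of "- k"]]
    by (simp add: D_def algebra_simps)
  have per: "cdiff S m g (z + of_real T) * E (- k) (z + of_real T) = cdiff S m g z * E (- k) z" if "z \<in> S" for m z
    using that by (simp only: cdiff_periodic[OF g] E_periodic)
  have cD: "continuous_on S (D m)" for m
    unfolding D_def by (intro continuous_on_add continuous_on_mult_left c)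
  have rec: "line_int 0 (\<lambda>z. cdiff S (Suc m) g z * E (- k) z) =
      (\<i> * of_int k * of_real L) * line_int 0 (\<lambda>z. cdiff S m g z * E (- k) z)" for m
  proof -
    have "\<bar>0::real\<bar> \<le> d" using d_nonneg by simp
    moreover from this have "line_int 0 (D m) = 0"
      using line_int_derivative[of "\<lambda>z. cdiff S m g z * E (- k) z" "D m" 0] D per by blast
    moreover have "line_int 0 (D m) = line_int 0 (\<lambda>z. cdiff S (Suc m) g z * E (- k) z) +
        (- (\<i> * of_int k * of_real L)) * line_int 0 (\<lambda>z. cdiff S m g z * E (- k) z)"
      unfolding D_def
      by (simp only: line_int_add[OF c continuous_on_mult_left[OF c] \<open>\<bar>0\<bar> \<le> d\<close>] line_int_cmult[OF c \<open>\<bar>0\<bar> \<le> d\<close>])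
    ultimately show ?thesis by simp
  qed
  have "line_int 0 (\<lambda>z. cdiff S m g z * E (- k) z) = (\<i> * of_int k * of_real L) ^ m * (coef g k * of_real T)"
  proof (induction m)
    case 0
    then show ?case using T_pos by (simp add: coef_def)
  next
    case (Suc m)
    then show ?case unfolding rec by simp
  qed
  then show ?thesis using line_int_const[of "\<lambda>z. cdiff S m g z * E (- k) z" "D m" y] D cD per y by metis
qed

text \<open>The coefficient integral may be moved to the lowest horizontal line of the strip,
  where \<^term>\<open>E (- k)\<close> has modulus \<open>q powr (- d k)\<close>; the powers of \<open>k\<close> come from
  integrating by parts.\<close>

lemma coef_decay:
  assumes g: "g \<in> H_rad q p"
  shows "real q powr (d * real k) * (real k * L) ^ m * cmod (coef g (int k)) \<le> mu_sn p m g"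
proof -
  have c: "continuous_on S (\<lambda>z. cdiff S m g z * E (- int k) z)"
    by (intro continuous_intros H_rad_continuous g)
  have "cmod (line_int (- d) (\<lambda>z. cdiff S m g z * E (- int k) z)) \<le> (mu_sn p m g * real q powr - (d * real k)) * T"
  proof (rule cmod_line_int_le[OF c])
    fix t :: real
    have "cmod (E (- int k) (of_real t + \<i> * of_real (- d))) = real q powr - (d * real k)"
      unfolding cmod_E by (simp add: mult.commute)
    then show "cmod (cdiff S m g (of_real t + \<i> * of_real (- d)) * E (- int k) (of_real t + \<i> * of_real (- d)))
        \<le> mu_sn p m g * real q powr - (d * real k)"
      unfolding norm_mult using cmod_cdiff_le_mu[OF g line_in_strip, of "- d" m t] d_nonneg
      by (simp add: mult_right_mono)
  qed (use d_nonneg in simp)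
  then have "(real k * L) ^ m * cmod (coef g (int k)) * T \<le> (mu_sn p m g * real q powr - (d * real k)) * T"
    using L_pos T_pos d_nonneg unfolding line_int_coef[OF g, of "- d" m "int k", unfolded abs_minus_cancel abs_of_nonneg[OF d_nonneg], OF order_refl]
    by (simp add: norm_mult norm_power power_mult_distrib mult_ac)
  then have "(real k * L) ^ m * cmod (coef g (int k)) \<le> mu_sn p m g * real q powr - (d * real k)"
    using T_pos by simp
  then show ?thesis
    using q2 by (simp add: powr_minus field_simps)
qed

lemma coef_minus:
  assumes g: "g \<in> H_rad q p" shows "coef g (- k) = coef g k"
proof -
  define h where "h t = g (of_real t) * E (- k) (of_real t)" for t :: real
  have r: "of_real t \<in> S" for t using d_nonneg by (simp add: in_strip_iff)
  have h: "g (of_real t) * E k (of_real t) = h (T - t)" for t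
  proof -
    have "g (of_real (T - t)) = g (of_real t)"
      using H_rad_periodic[OF g r[of "- t"]] H_rad_even[OF g r[of t]] by (simp add: algebra_simps)
    moreover have "E (- k) (of_real (T - t)) = E k (of_real t)"
      using E_periodic[of "- k" "- of_real t"] by (simp add: E_uminus algebra_simps)
    ultimately show ?thesis by (simp add: h_def)
  qed
  have "continuous_on {0..T} h"
    unfolding h_def using H_rad_continuous[OF g, of 0] r
    by (auto intro!: continuous_intros continuous_on_compose2[of S g])
  then have "(h has_integral integral {0..T} h) {- T + T..0 + T}"
    by (simp add: integrable_continuous_real integrable_integral)
  then have "((\<lambda>t. (h \<circ> (+) T) (- t)) has_integral integral {0..T} h) {- 0..- (- T)}"
    unfolding has_integral_shift_Icc_real[symmetric] has_integral_reflect_real .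
  then have "integral {0..T} (\<lambda>t. h (T - t)) = integral {0..T} h"
    by (simp add: o_def integral_unique)
  moreover have "line_int 0 (\<lambda>z. g z * E (- (- k)) z) = integral {0..T} (\<lambda>t. h (T - t))"
    by (simp add: line_int_def h)
  moreover have "line_int 0 (\<lambda>z. g z * E (- k) z) = integral {0..T} h"
    by (simp add: line_int_def h_def[abs_def])
  ultimately show ?thesis by (simp only: coef_def)
qed

lemma H_rad_coef_zero_imp_zero:
  assumes g: "g \<in> H_rad q p" and zero: "\<And>k. coef g k = 0"
  shows "g z = 0"
proof (cases "z \<in> S")
  case True
  define y where "y = Im z"
  have y: "\<bar>y\<bar> \<le> d" using True by (simp add: y_def in_strip_iff)
  define h where "h t = g (of_real t + \<i> * of_real y)" for t :: real
  have hper: "h (t + T) = h t" for t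
    using H_rad_periodic[OF g line_in_strip[OF y, of t]] by (simp add: h_def algebra_simps)
  have hcont: "continuous_on A h" for A
    unfolding h_def using H_rad_continuous[OF g, of 0] y by (intro continuous_on_line) auto
  have "integral {0..T} (\<lambda>t. h t * cis (of_int k * (L * t))) = 0" for k
  proof -
    have "line_int y (\<lambda>z. g z * E k z) = 0"
      using line_int_coef[OF g y, of 0 "- k"] zero by simp
    then have "integral {0..T} (\<lambda>t. h t * cis (of_int k * (L * t)) * E k (\<i> * of_real y)) = 0"
      by (simp add: line_int_def h_def E_shift E_of_real mult.assoc)
    then show ?thesis by simp
  qed
  then have h0: "h t = 0" if "t \<in> {0..T}" for t
    using Fourier_coefficients_zero_imp_zero[OF L_pos _ hcont _ _ that] hper[of 0]
    by (simp add: tau_def)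
  interpret h: periodic_fun_simple h T by unfold_locales (rule hper)
  define n where "n = \<lfloor>Re z / T\<rfloor>"
  have "of_int n \<le> Re z / T" "Re z / T \<le> of_int n + 1" by (simp_all add: n_def)
  then have "Re z - of_int n * T \<in> {0..T}"
    using T_pos by (simp add: field_simps)
  then have "h (Re z) = 0" using h0 h.minus_of_int[of "Re z" n] by simp
  moreover have "z = of_real (Re z) + \<i> * of_real y" by (simp add: complex_eq_iff y_def)
  ultimately show ?thesis unfolding h_def by simp
qed (use H_rad_outside[OF g] in simp)

section \<open>Transform and inversion for rapidly decreasing sequences\<close>

definition weight :: "nat \<Rightarrow> nat \<Rightarrow> real" where
  "weight m n = (1 + real n) ^ m * real q powr (d * real n)"

definition rapid :: "(nat \<Rightarrow> complex) \<Rightarrow> bool" where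
  "rapid G \<longleftrightarrow> (\<forall>m. bdd_above (range (\<lambda>n. weight m n * cmod (G n))))"

definition rapid_norm :: "nat \<Rightarrow> (nat \<Rightarrow> complex) \<Rightarrow> real" where
  "rapid_norm m G = (SUP n. weight m n * cmod (G n))"

lemma weight_pos: "weight m n > 0"
  unfolding weight_def using q2 by (intro mult_pos_pos zero_less_power) auto

lemma weight_mono: "k \<le> n \<Longrightarrow> weight m k \<le> weight m n"
  unfolding weight_def using q2 d_nonneg
  by (intro mult_mono power_mono powr_mono mult_left_mono) auto

lemma weight_ge_1: "weight m n \<ge> 1"
  using weight_mono[of 0 n m] q2 by (simp add: weight_def)

lemma weight_add: "weight (m + j) n = (1 + real n) ^ j * weight m n"
  by (simp add: weight_def power_add)

lemma le_rapid_norm: "rapid G \<Longrightarrow> weight m n * cmod (G n) \<le> rapid_norm m G"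
  unfolding rapid_def rapid_norm_def by (rule cSUP_upper) auto

lemma rapid_norm_le: "(\<And>n. weight m n * cmod (G n) \<le> B) \<Longrightarrow> rapid_norm m G \<le> B"
  unfolding rapid_norm_def by (rule cSUP_least) auto

lemma rapidI: "(\<And>m n. weight m n * cmod (G n) \<le> B m) \<Longrightarrow> rapid G"
  unfolding rapid_def by (meson bdd_aboveI2)

lemma rapid_bounded: assumes "rapid G" shows "cmod (G n) \<le> rapid_norm 0 G"
  using le_rapid_norm[OF assms, of 0 n] mult_right_mono[OF weight_ge_1[of 0 n], of "cmod (G n)"] by simp

definition sph_coeff :: "nat \<Rightarrow> nat \<Rightarrow> real" where
  "sph_coeff n l = (if l = 0 \<or> l = n then 1 else 1 - 1 / real q)"

lemma sph_coeff_bounds: "0 \<le> sph_coeff n l" "sph_coeff n l \<le> 1"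
  using q2 by (auto simp: sph_coeff_def)

text \<open>\<^term>\<open>sph_poly m n\<close> is the \<open>m\<close>-th derivative of the Laurent polynomial
  \<open>card (sphere_t q n) q^(-n/2) sph\<close> in \<open>q^(iz)\<close>; see \<open>sph_eq_sph_poly\<close>.\<close>

definition sph_poly :: "nat \<Rightarrow> nat \<Rightarrow> complex \<Rightarrow> complex" where
  "sph_poly m n z = (\<Sum>l\<le>n. of_real (sph_coeff n l) * (\<i> * of_int (2 * int l - int n) * of_real L) ^ m * E (2 * int l - int n) z)"

lemma sph_poly_deriv: "(sph_poly m n has_field_derivative sph_poly (Suc m) n z) (at z within A)"
proof -
  have "(sph_poly m n has_field_derivative (\<Sum>l\<le>n. of_real (sph_coeff n l) * (\<i> * of_int (2 * int l - int n) * of_real L) ^ m *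
      (\<i> * of_int (2 * int l - int n) * of_real L * E (2 * int l - int n) z))) (at z within A)"
    unfolding sph_poly_def by (intro DERIV_sum DERIV_cmult E_has_field_derivative)
  also have "(\<Sum>l\<le>n. of_real (sph_coeff n l) * (\<i> * of_int (2 * int l - int n) * of_real L) ^ m *
      (\<i> * of_int (2 * int l - int n) * of_real L * E (2 * int l - int n) z)) = sph_poly (Suc m) n z"
    unfolding sph_poly_def by (intro sum.cong refl) (simp only: power_Suc mult_ac)
  finally show ?thesis .
qed

lemma continuous_on_sph_poly: "continuous_on A (sph_poly m n)"
  using sph_poly_deriv continuous_on_eq_continuous_within DERIV_continuous by blast

lemma cmod_sph_poly_le:
  assumes "z \<in> S" shows "cmod (sph_poly m n z) \<le> L ^ m * weight (Suc m) n"
proof -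
  have "cmod (sph_poly m n z) \<le> (\<Sum>l\<le>n. 1 * (real n * L) ^ m * real q powr (d * real n))"
    unfolding sph_poly_def
  proof (rule sum_norm_le)
    fix l assume l: "l \<in> {..n}"
    have "cmod (of_int (2 * int l - int n) :: complex) \<le> real n"
      using l unfolding norm_of_int by simp
    then have "cmod (\<i> * of_int (2 * int l - int n) * of_real L) \<le> real n * L"
      using L_pos unfolding norm_mult by simp
    then have 2: "cmod ((\<i> * of_int (2 * int l - int n) * of_real L) ^ m) \<le> (real n * L) ^ m"
      unfolding norm_power by (rule power_mono) simp
    have 3: "cmod (E (2 * int l - int n) z) \<le> real q powr (d * real n)"
      using l by (intro cmod_E_le assms) auto
    show "cmod (of_real (sph_coeff n l) * (\<i> * of_int (2 * int l - int n) * of_real L) ^ m * E (2 * int l - int n) z)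
        \<le> 1 * (real n * L) ^ m * real q powr (d * real n)"
      unfolding norm_mult using sph_coeff_bounds[of n l] 2 3 L_pos
      by (intro mult_mono) auto
  qed
  also have "\<dots> = L ^ m * ((1 + real n) * real n ^ m * real q powr (d * real n))"
    by (simp add: power_mult_distrib)
  also have "\<dots> \<le> L ^ m * weight (Suc m) n"
    unfolding weight_def power_Suc using L_pos
    by (intro mult_left_mono mult_right_mono power_mono) auto
  finally show ?thesis .
qed

lemma sph_poly_even: "sph_poly 0 n (- z) = sph_poly 0 n z"
  unfolding sph_poly_def
  by (rule sum.reindex_bij_witness[of _ "\<lambda>l. n - l" "\<lambda>l. n - l"])
     (auto simp: sph_coeff_def E_uminus of_nat_diff)

lemma sph_poly_periodic: "sph_poly m n (z + of_real T) = sph_poly m n z"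
  unfolding sph_poly_def E_periodic ..

definition synth :: "nat \<Rightarrow> (nat \<Rightarrow> complex) \<Rightarrow> complex \<Rightarrow> complex" where
  "synth m G z = (\<Sum>n. G n * sph_poly m n z)"

definition sum_inv_squares :: real where "sum_inv_squares = (\<Sum>n. 1 / (1 + real n)\<^sup>2)"

lemma summable_sum_inv_squares: "summable (\<lambda>n. 1 / (1 + real n)\<^sup>2)"
  using inverse_squares_sums by (auto simp: sums_iff add.commute)

lemma cmod_term_le:
  assumes G: "rapid G" and z: "z \<in> S"
  shows "cmod (G n * sph_poly m n z) \<le> L ^ m * rapid_norm (m + 3) G * (1 / (1 + real n)\<^sup>2)"
proof -
  have "cmod (G n * sph_poly m n z) \<le> cmod (G n) * (L ^ m * weight (Suc m) n)"
    unfolding norm_mult by (intro mult_left_mono cmod_sph_poly_le z) auto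
  also have "\<dots> = L ^ m * (weight (m + 3) n * cmod (G n)) * (1 / (1 + real n)\<^sup>2)"
    using weight_add[of "Suc m" 2 n] by (simp add: numeral_3_eq_3 field_simps)
  also have "\<dots> \<le> L ^ m * rapid_norm (m + 3) G * (1 / (1 + real n)\<^sup>2)"
    using L_pos by (intro mult_right_mono mult_left_mono le_rapid_norm G) auto
  finally show ?thesis .
qed

lemma summable_bound: "summable (\<lambda>n. C * (1 / (1 + real n)\<^sup>2))"
  by (intro summable_mult summable_sum_inv_squares)

lemma synth_sums: "rapid G \<Longrightarrow> z \<in> S \<Longrightarrow> (\<lambda>n. G n * sph_poly m n z) sums synth m G z"
  unfolding synth_def
  by (intro summable_sums summable_comparison_test'[OF summable_bound cmod_term_le])

lemma cmod_synth_le: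
  assumes "rapid G" "z \<in> S" shows "cmod (synth m G z) \<le> L ^ m * sum_inv_squares * rapid_norm (m + 3) G"
proof -
  have "cmod (synth m G z) \<le> (\<Sum>n. L ^ m * rapid_norm (m + 3) G * (1 / (1 + real n)\<^sup>2))"
    unfolding synth_def by (intro norm_suminf_le cmod_term_le assms summable_bound)
  also have "\<dots> = L ^ m * rapid_norm (m + 3) G * sum_inv_squares"
    unfolding sum_inv_squares_def by (rule suminf_mult[OF summable_sum_inv_squares])
  finally show ?thesis by (simp only: mult_ac)
qed

lemma synth_deriv:
  assumes G: "rapid G" and z: "z \<in> S"
  shows "(synth m G has_field_derivative synth (Suc m) G z) (at z within S)"
proof -
  have "uniform_limit S (\<lambda>N z. \<Sum>n<N. G n * sph_poly (Suc m) n z) (synth (Suc m) G) sequentially"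
    unfolding synth_def by (rule Weierstrass_m_test[OF cmod_term_le[OF G] summable_bound])
  then have "\<exists>g. \<forall>x\<in>S. (\<lambda>n. G n * sph_poly m n x) sums g x \<and> (g has_field_derivative synth (Suc m) G x) (at x within S)"
    by (rule has_field_derivative_series[OF convex_strip DERIV_cmult[OF sph_poly_deriv] _ z])
       (rule sums_summable[OF synth_sums[OF G z]])
  then obtain g where g: "\<And>x. x \<in> S \<Longrightarrow> (\<lambda>n. G n * sph_poly m n x) sums g x"
    and g': "(g has_field_derivative synth (Suc m) G z) (at z within S)" using z by blast
  show ?thesis
    by (rule strip_deriv_cong[OF g' z]) (rule sums_unique2[OF synth_sums[OF G] g])
qed

definition radial_transform :: "(nat \<Rightarrow> complex) \<Rightarrow> complex \<Rightarrow> complex" where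
  "radial_transform G z = (if z \<in> S then synth 0 G z else 0)"

lemma cdiff_radial_transform: "rapid G \<Longrightarrow> z \<in> S \<Longrightarrow> cdiff S m (radial_transform G) z = synth m G z"
  by (rule cdiff_eq) (auto simp: radial_transform_def intro: synth_deriv)

lemma radial_transform_in_H_rad:
  assumes "rapid G" shows "radial_transform G \<in> H_rad q p"
proof (rule H_rad_memI[where D = "\<lambda>m. synth m G"])
  fix z assume z: "z \<in> S"
  then have "- z \<in> S" by (simp add: in_strip_iff)
  then show "radial_transform G (- z) = radial_transform G z" using z by (simp add: radial_transform_def synth_def sph_poly_even)
  show "radial_transform G (z + of_real T) = radial_transform G z" using z strip_shift[OF z] by (simp add: radial_transform_def synth_def sph_poly_periodic)
next
  fix m show "bdd_above ((\<lambda>z. cmod (synth m G z)) ` S)"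
    by (rule bdd_aboveI2[OF cmod_synth_le[OF assms]])
qed (use assms in \<open>auto simp: radial_transform_def intro: synth_deriv\<close>)

lemma mu_radial_transform_le: "rapid G \<Longrightarrow> mu_sn p m (radial_transform G) \<le> L ^ m * sum_inv_squares * rapid_norm (m + 3) G"
  by (rule mu_le) (simp add: cdiff_radial_transform cmod_synth_le)

lemma line_int_E: "line_int 0 (E j) = (if j = 0 then of_real T else 0)"
proof (cases "j = 0")
  case True
  then show ?thesis using T_pos by (simp add: line_int_def E_def scaleR_conv_of_real)
next
  case False
  define c where "c = inverse (\<i> * of_int j * of_real L)"
  have "c * (\<i> * of_int j * of_real L * E j z) = E j z" for z
    using left_inverse[of "\<i> * of_int j * of_real L"] False L_pos
    unfolding c_def mult.assoc[symmetric] by force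
  then have "((\<lambda>z. c * E j z) has_field_derivative E j z) (at z within S)" for z
    using DERIV_cmult[OF E_has_field_derivative, of c j] by metis
  then show ?thesis
    using line_int_derivative[of "\<lambda>z. c * E j z" "E j" 0] d_nonneg False by (simp add: E_periodic)
qed

lemma coef_sph_poly: "coef (sph_poly 0 n) k = (\<Sum>l\<le>n. if 2 * int l - int n = k then of_real (sph_coeff n l) else 0)"
proof -
  have "((\<lambda>t. \<Sum>l\<le>n. of_real (sph_coeff n l) * E (2 * int l - int n - k) (of_real t + \<i> * of_real 0)) has_integral
      (\<Sum>l\<le>n. of_real (sph_coeff n l) * line_int 0 (E (2 * int l - int n - k)))) {0..T}"
    by (intro has_integral_sum has_integral_mult_right has_integral_line continuous_on_E[OF continuous_on_id, unfolded id_def])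
      (use d_nonneg in auto)
  moreover have "(\<Sum>l\<le>n. of_real (sph_coeff n l) * E (2 * int l - int n - k) z) = sph_poly 0 n z * E (- k) z" for z
    by (auto simp: sph_poly_def sum_distrib_right mult.assoc simp flip: E_add)
  ultimately have "((\<lambda>t. sph_poly 0 n (of_real t + \<i> * of_real 0) * E (- k) (of_real t + \<i> * of_real 0)) has_integral
      (\<Sum>l\<le>n. of_real (sph_coeff n l) * line_int 0 (E (2 * int l - int n - k)))) {0..T}"
    by (simp only:)
  then have "line_int 0 (\<lambda>t. sph_poly 0 n t * E (- k) t) = (\<Sum>l\<le>n. of_real (sph_coeff n l) * line_int 0 (E (2 * int l - int n - k)))"
    unfolding line_int_def by (rule integral_unique)
  then show ?thesis
    unfolding coef_def by (simp only: line_int_E sum_divide_distrib) (use T_pos in \<open>auto intro!: sum.cong\<close>)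
qed

lemma coef_sph_poly_nat:
  "coef (sph_poly 0 n) (int k) = (if n = k then 1 else if k < n \<and> even (n - k) then 1 - 1 / of_nat q else 0)"
proof (cases "k \<le> n \<and> even (n - k)")
  case True
  then obtain j where n: "n = k + 2 * j" by (metis evenE le_add_diff_inverse)
  have "coef (sph_poly 0 n) (int k) = (\<Sum>l\<le>n. if l = k + j then of_real (sph_coeff n l) else 0)"
    unfolding coef_sph_poly by (intro sum.cong) (auto simp: n)
  also have "\<dots> = of_real (sph_coeff n (k + j))" by (subst sum.delta) (auto simp: n)
  finally show ?thesis by (auto simp: n sph_coeff_def)
next
  case False
  have "2 * int l - int n \<noteq> int k" if "l \<le> n" for l
  proof
    assume "2 * int l - int n = int k"
    then have "n + k = 2 * l" by linarith
    then show False using False that by presburger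
  qed
  then have "coef (sph_poly 0 n) (int k) = 0" unfolding coef_sph_poly by (intro sum.neutral) auto
  then show ?thesis using False by auto
qed

lemma coef_sph_poly_step:
  "coef (sph_poly 0 n) (int k) - coef (sph_poly 0 n) (int (k + 2)) =
     (if n = k then 1 else if n = k + 2 then - 1 / of_nat q else 0)"
  unfolding coef_sph_poly_nat by (cases "n = k"; cases "n = k + 2") (auto, presburger+)

lemma coef_radial_transform_sums:
  assumes G: "rapid G"
  shows "(\<lambda>n. G n * coef (sph_poly 0 n) k) sums coef (radial_transform G) k"
proof -
  have S0: "complex_of_real t \<in> S" for t using d_nonneg by (simp add: in_strip_iff)
  let ?f = "\<lambda>n t. G n * (sph_poly 0 n (of_real t) * E (- k) (of_real t))"
  have nE: "cmod (E (- k) (of_real t)) = 1" for t by (simp add: E_of_real)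
  have "uniform_limit {0..T} (\<lambda>N t. \<Sum>n<N. ?f n t) (\<lambda>t. \<Sum>n. ?f n t) sequentially"
  proof (rule Weierstrass_m_test[OF _ summable_bound])
    fix n t
    show "cmod (?f n t) \<le> rapid_norm 3 G * (1 / (1 + real n)\<^sup>2)"
      using cmod_term_le[OF G S0, of n 0 t] by (simp add: norm_mult nE)
  qed
  moreover have c: "continuous_on {0..T} (?f n)" for n
    by (intro continuous_intros continuous_on_compose2[OF continuous_on_sph_poly[of UNIV]]) auto
  then have "continuous_on {0..T} (\<lambda>t. \<Sum>n<N. ?f n t)" for N
    by (intro continuous_on_sum)
  ultimately obtain I J where I: "\<And>N. ((\<lambda>t. \<Sum>n<N. ?f n t) has_integral I N) {0..T}"
     and J: "((\<lambda>t. \<Sum>n. ?f n t) has_integral J) {0..T}" and IJ: "I \<longlonglongrightarrow> J"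
    by (rule uniform_limit_integral) auto
  have "((\<lambda>t. \<Sum>n<N. ?f n t) has_integral (\<Sum>n<N. G n * (coef (sph_poly 0 n) k * of_real T))) {0..T}" for N
  proof (intro has_integral_sum)
    fix n
    have "(?f n has_integral integral {0..T} (?f n)) {0..T}"
      using c by (intro integrable_integral integrable_continuous_real)
    then show "(?f n has_integral G n * (coef (sph_poly 0 n) k * of_real T)) {0..T}"
      using T_pos by (simp add: coef_def line_int_def)
  qed auto
  then have "I = (\<lambda>N. \<Sum>n<N. G n * (coef (sph_poly 0 n) k * of_real T))"
    using I has_integral_unique by blast
  moreover have "J = coef (radial_transform G) k * of_real T"
  proof -
    have "(\<Sum>n. ?f n t) = radial_transform G (of_real t) * E (- k) (of_real t)" for t
      using sums_mult2[OF synth_sums[OF G S0, of 0 t], of "E (- k) (of_real t)"] S0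
      by (simp add: radial_transform_def sums_iff mult.assoc)
    then show ?thesis using J T_pos by (simp add: coef_def line_int_def integral_unique)
  qed
  ultimately have "(\<lambda>n. G n * (coef (sph_poly 0 n) k * of_real T)) sums (coef (radial_transform G) k * of_real T)"
    using IJ by (simp add: sums_def)
  from sums_divide[OF this, of "of_real T"] show ?thesis using T_pos by simp
qed

lemma coef_radial_transform_step:
  assumes G: "rapid G"
  shows "coef (radial_transform G) (int k) - coef (radial_transform G) (int (k + 2)) = G k - G (k + 2) / of_nat q"
proof -
  have "(\<lambda>n. G n * (coef (sph_poly 0 n) (int k) - coef (sph_poly 0 n) (int (k + 2)))) sums
     (coef (radial_transform G) (int k) - coef (radial_transform G) (int (k + 2)))"
    using sums_diff[OF coef_radial_transform_sums[OF G, of "int k"] coef_radial_transform_sums[OF G, of "int (k + 2)"]]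
    by (simp add: algebra_simps)
  moreover have "(\<lambda>n. G n * (coef (sph_poly 0 n) (int k) - coef (sph_poly 0 n) (int (k + 2)))) sums
     (\<Sum>n\<in>{k, k + 2}. G n * (coef (sph_poly 0 n) (int k) - coef (sph_poly 0 n) (int (k + 2))))"
    by (intro sums_finite) (auto simp only: coef_sph_poly_step insert_iff empty_iff if_False mult_zero_right finite_insert finite.emptyI simp_thms split: if_splits)
  ultimately show ?thesis
    unfolding coef_sph_poly_step by (auto dest: sums_unique2)
qed

text \<open>By \<open>coef_radial_transform_step\<close>, the differences \<open>b k - b (k + 2)\<close> of the Fourier coefficients
  determine \<open>G\<close> through \<open>G k - G (k + 2) / q\<close>; iterating this relation gives the following series.\<close>

definition diff_series :: "(nat \<Rightarrow> complex) \<Rightarrow> nat \<Rightarrow> complex" where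
  "diff_series b k = (\<Sum>j. (b (k + 2 * j) - b (k + 2 * j + 2)) / of_nat q ^ j)"

lemma diff_series_term_le:
  assumes B: "\<And>n. weight m n * cmod (b n) \<le> B"
  shows "cmod ((b (k + 2 * j) - b (k + 2 * j + 2)) / of_nat q ^ j) \<le> 2 * B / weight m k * (1 / 2) ^ j"
proof -
  have le: "cmod (b n) \<le> B / weight m k" if "k \<le> n" for n
  proof -
    have "weight m k * cmod (b n) \<le> B"
      using B[of n] mult_right_mono[OF weight_mono[OF that, of m], of "cmod (b n)"] by simp
    then show ?thesis using weight_pos[of m k] by (simp add: field_simps)
  qed
  have "cmod (b (k + 2 * j) - b (k + 2 * j + 2)) \<le> 2 * B / weight m k"
    using norm_triangle_ineq4[of "b (k + 2 * j)" "b (k + 2 * j + 2)"] le[of "k + 2 * j"] le[of "k + 2 * j + 2"]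
    by simp
  moreover have "1 / real q ^ j \<le> (1 / 2) ^ j"
    using q2 by (simp add: power_one_over frac_le power_mono)
  ultimately have "cmod (b (k + 2 * j) - b (k + 2 * j + 2)) * (1 / real q ^ j) \<le> 2 * B / weight m k * (1 / 2) ^ j"
    using q2 by (intro mult_mono) (auto intro: order_trans[OF norm_ge_zero])
  then show ?thesis by (simp add: norm_divide norm_power)
qed

lemma diff_series_summable:
  assumes "\<And>n. weight m n * cmod (b n) \<le> B"
  shows "summable (\<lambda>j. (b (k + 2 * j) - b (k + 2 * j + 2)) / of_nat q ^ j)"
  by (rule summable_comparison_test'[OF _ diff_series_term_le[OF assms]])
     (intro summable_mult summable_geometric, simp)

lemma diff_series_le:
  assumes "\<And>n. weight m n * cmod (b n) \<le> B"
  shows "weight m k * cmod (diff_series b k) \<le> 4 * B"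
proof -
  have "cmod (diff_series b k) \<le> (\<Sum>j. 2 * B / weight m k * (1 / 2) ^ j)"
    unfolding diff_series_def
    by (rule norm_suminf_le[OF diff_series_term_le[OF assms]]) (intro summable_mult summable_geometric, simp)
  also have "\<dots> = 4 * B / weight m k"
    by (subst suminf_mult) (auto intro: summable_geometric simp: suminf_geometric)
  finally show ?thesis using weight_pos[of m k] by (simp add: field_simps)
qed

lemma diff_series_step:
  assumes "\<And>n. weight m n * cmod (b n) \<le> B"
  shows "diff_series b k - diff_series b (k + 2) / of_nat q = b k - b (k + 2)"
proof -
  have "diff_series b k = (b k - b (k + 2)) + (\<Sum>j. (b (k + 2 * Suc j) - b (k + 2 * Suc j + 2)) / of_nat q ^ Suc j)"
    unfolding diff_series_def using suminf_split_head[OF diff_series_summable[OF assms]] by simp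
  also have "(\<lambda>j. (b (k + 2 * Suc j) - b (k + 2 * Suc j + 2)) / of_nat q ^ Suc j) =
      (\<lambda>j. (b (k + 2 + 2 * j) - b (k + 2 + 2 * j + 2)) / of_nat q ^ j / of_nat q)"
    by (simp add: algebra_simps)
  also have "(\<Sum>j. (b (k + 2 + 2 * j) - b (k + 2 + 2 * j + 2)) / of_nat q ^ j / of_nat q) = diff_series b (k + 2) / of_nat q"
    unfolding diff_series_def by (rule suminf_divide[OF diff_series_summable[OF assms]])
  finally show ?thesis by simp
qed

lemma diff_series_unique:
  assumes G: "rapid G" and step: "\<And>k. b k - b (k + 2) = G k - G (k + 2) / of_nat q"
  shows "diff_series b k = G k"
proof -
  have "(\<lambda>j. G (k + 2 * j) / of_nat q ^ j) \<longlonglongrightarrow> 0"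
  proof (rule Lim_null_comparison)
    show "\<forall>\<^sub>F j in sequentially. cmod (G (k + 2 * j) / of_nat q ^ j) \<le> rapid_norm 0 G * (1 / real q) ^ j"
      using rapid_bounded[OF G] q2 by (auto simp: norm_divide norm_power power_one_over field_simps)
    show "(\<lambda>j. rapid_norm 0 G * (1 / real q) ^ j) \<longlonglongrightarrow> 0"
      using q2 by (intro tendsto_mult_right_zero LIMSEQ_power_zero) simp
  qed
  from telescope_sums'[OF this]
  have "(\<lambda>j. G (k + 2 * j) / of_nat q ^ j - G (k + 2 * Suc j) / of_nat q ^ Suc j) sums G k" by simp
  moreover have "G (k + 2 * j) / of_nat q ^ j - G (k + 2 * Suc j) / of_nat q ^ Suc j =
      (b (k + 2 * j) - b (k + 2 * j + 2)) / of_nat q ^ j" for j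
    unfolding step by (simp add: diff_divide_distrib)
  ultimately show ?thesis unfolding diff_series_def by (simp add: sums_iff)
qed

definition inv_coeffs :: "(complex \<Rightarrow> complex) \<Rightarrow> nat \<Rightarrow> complex" where
  "inv_coeffs g = diff_series (\<lambda>n. coef g (int n))"

lemma mu_nonneg: assumes "g \<in> H_rad q p" shows "mu_sn p m g \<ge> 0"
proof -
  have "0 \<in> S" using d_nonneg by (simp add: in_strip_iff)
  from order_trans[OF norm_ge_zero cmod_cdiff_le_mu[OF assms this]] show ?thesis .
qed

lemma weight_coef_le:
  assumes g: "g \<in> H_rad q p"
  shows "weight m n * cmod (coef g (int n)) \<le> 2 ^ m * (mu_sn p 0 g + mu_sn p m g / L ^ m)"
proof -
  have "(1 + real n) ^ m \<le> 2 ^ m * (1 + real n ^ m)"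
  proof (cases "n = 0")
    case False
    then have "(1 + real n) ^ m \<le> (2 * real n) ^ m" by (intro power_mono) auto
    then show ?thesis by (simp add: power_mult_distrib algebra_simps add_increasing)
  next
    case True
    have "1 * 1 \<le> 2 ^ m * (1 + (0::real) ^ m)" by (intro mult_mono) auto
    then show ?thesis using True by simp
  qed
  then have "weight m n * cmod (coef g (int n)) \<le> 2 ^ m * (1 + real n ^ m) * (real q powr (d * real n) * cmod (coef g (int n)))"
    unfolding weight_def mult.assoc[symmetric] by (intro mult_right_mono) auto
  also have "\<dots> = 2 ^ m * (real q powr (d * real n) * (real n * L) ^ 0 * cmod (coef g (int n)) +
      real q powr (d * real n) * (real n * L) ^ m * cmod (coef g (int n)) / L ^ m)"
    using L_pos by (simp add: power_mult_distrib field_simps)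
  also have "\<dots> \<le> 2 ^ m * (mu_sn p 0 g + mu_sn p m g / L ^ m)"
    using L_pos by (intro mult_left_mono add_mono divide_right_mono coef_decay g) auto
  finally show ?thesis .
qed

lemma weight_inv_coeffs_le:
  "g \<in> H_rad q p \<Longrightarrow> weight m n * cmod (inv_coeffs g n) \<le> 4 * (2 ^ m * (mu_sn p 0 g + mu_sn p m g / L ^ m))"
  unfolding inv_coeffs_def by (rule diff_series_le[OF weight_coef_le])

lemma rapid_inv_coeffs: "g \<in> H_rad q p \<Longrightarrow> rapid (inv_coeffs g)"
  by (rule rapidI[OF weight_inv_coeffs_le])

lemma inv_coeffs_radial_transform: "rapid G \<Longrightarrow> inv_coeffs (radial_transform G) = G"
  unfolding inv_coeffs_def using coef_radial_transform_step by (intro ext diff_series_unique)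

lemma coef_diff:
  assumes "f \<in> H_rad q p" "g \<in> H_rad q p"
  shows "coef (\<lambda>z. f z - g z) k = coef f k - coef g k"
proof -
  have c: "continuous_on S (\<lambda>z. f z * E (- k) z)" "continuous_on S (\<lambda>z. - 1 * (g z * E (- k) z))"
    using H_rad_continuous[OF assms(1), of 0] H_rad_continuous[OF assms(2), of 0]
    by (auto intro!: continuous_intros)
  have "line_int 0 (\<lambda>z. f z * E (- k) z + - 1 * (g z * E (- k) z)) =
      line_int 0 (\<lambda>z. f z * E (- k) z) + - 1 * line_int 0 (\<lambda>z. g z * E (- k) z)"
    using line_int_add[OF c, of 0] d_nonneg by (simp add: line_int_def)
  then show ?thesis by (simp add: coef_def left_diff_distrib diff_divide_distrib)
qed

lemma radial_transform_inv_coeffs: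
  assumes g: "g \<in> H_rad q p" shows "radial_transform (inv_coeffs g) = g"
proof -
  define h where "h = (\<lambda>z. g z - radial_transform (inv_coeffs g) z)"
  have h: "h \<in> H_rad q p"
    unfolding h_def by (intro H_rad_diff radial_transform_in_H_rad rapid_inv_coeffs g)
  have coef_h: "coef h k = coef g k - coef (radial_transform (inv_coeffs g)) k" for k
    unfolding h_def by (intro coef_diff radial_transform_in_H_rad rapid_inv_coeffs g)
  have step: "coef h (int k) = coef h (int (k + 2))" for k
  proof -
    have "coef g (int k) - coef g (int (k + 2)) = coef (radial_transform (inv_coeffs g)) (int k) - coef (radial_transform (inv_coeffs g)) (int (k + 2))"
      using coef_radial_transform_step[OF rapid_inv_coeffs[OF g], of k] diff_series_step[OF weight_coef_le[OF g], of k, folded inv_coeffs_def]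
      by (simp only:)
    then show ?thesis unfolding coef_h by (simp add: algebra_simps)
  qed
  have nat: "coef h (int k) = 0" for k
  proof -
    have eq: "coef h (int (k + 2 * j)) = coef h (int k)" for j
    proof (induction j)
      case (Suc j)
      have "coef h (int (k + 2 * Suc j)) = coef h (int (k + 2 * j))"
        using step[of "k + 2 * j"] by (simp add: algebra_simps)
      then show ?case using Suc.IH by (rule trans)
    qed simp
    define C where "C = 2 ^ 1 * (mu_sn p 0 h + mu_sn p 1 h / L ^ 1)"
    have "cmod (coef h (int k)) \<le> C / real (Suc j)" for j
    proof -
      have "real (Suc j) * 1 * cmod (coef h (int k)) \<le> weight 1 (k + 2 * j) * cmod (coef h (int (k + 2 * j)))"
        unfolding eq weight_def using q2 d_nonneg by (intro mult_right_mono mult_mono ge_one_powr_ge_zero) auto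
      also have "\<dots> \<le> C" unfolding C_def by (rule weight_coef_le[OF h])
      finally show ?thesis by (simp add: field_simps)
    qed
    then have "cmod (coef h (int k)) \<le> 0"
      by (intro LIMSEQ_le_const[OF lim_const_over_n[THEN LIMSEQ_Suc, of C]]) auto
    then show ?thesis by simp
  qed
  have "coef h k = 0" for k
    using nat[of "nat \<bar>k\<bar>"] coef_minus[OF h, of k] by (cases "k \<ge> 0") auto
  then have "h z = 0" for z by (rule H_rad_coef_zero_imp_zero[OF h])
  then show ?thesis by (auto simp: h_def)
qed

section \<open>The spherical transform of radial functions\<close>

lemma sphere_t_nonempty: "sphere_t q n \<noteq> {}"
proof (cases n)
  case (Suc m)
  then show ?thesis using card_sphere_t_Suc[of q m] q2 by fastforce
qed (simp add: sphere_t_0)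

lemma sph_eq_sph_poly:
  assumes x: "x \<in> sphere_t q n"
  shows "of_nat (card (sphere_t q n)) * sph q z x = of_real (real q powr (real n / 2)) * sph_poly 0 n z"
proof -
  have len: "length x = n" using x by (simp add: sphere_t_def)
  have card: "card (sphere_t q n) \<noteq> 0"
    using sphere_t_nonempty finite_sphere_t by (simp add: card_eq_0_iff)
  define g where "g l = qpow q ((1 / 2 + \<i> * z) * of_int (2 * int l - int n))" for l
  have g: "g l = of_real (real q powr (real l - real n / 2)) * E (2 * int l - int n) z" for l
  proof -
    have "(1 / 2 + \<i> * z) * of_int (2 * int l - int n) * of_real L =
        of_real ((real l - real n / 2) * L) + \<i> * of_int (2 * int l - int n) * of_real L * z"
      by (simp add: field_simps)
    then show ?thesis
      using q2 by (simp add: g_def qpow_def E_def exp_add powr_def exp_of_real flip: of_real_mult of_real_diff)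
  qed
  have "of_nat (card (sphere_t q n)) * sph q z x = (\<Sum>y\<in>sphere_t q n. g (lcp x y))"
    using card by (simp add: sph_def len horo_def g_def)
  also have "\<dots> = of_real (real q powr (real n / 2)) * sph_poly 0 n z"
  proof (cases n)
    case 0
    then show ?thesis using x q2 by (simp add: sphere_t_0 sph_poly_def g sph_coeff_def)
  next
    case (Suc m)
    have qp: "complex_of_nat q ^ k = of_real (real q powr real k)" for k
      using q2 by (simp add: powr_realpow)
    have 0: "of_nat q ^ Suc m * g 0 = of_real (real q powr (real n / 2)) * (of_real (sph_coeff n 0) * E (2 * int 0 - int n) z)"
    proof -
      have "of_nat q ^ Suc m * g 0 = of_real (real q powr real n * real q powr (0 - real n / 2)) * E (2 * int 0 - int n) z"
        unfolding g qp Suc by simp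
      also have "real q powr real n * real q powr (0 - real n / 2) = real q powr (real n / 2)"
        by (simp flip: powr_add)
      finally show ?thesis by (simp add: sph_coeff_def)
    qed
    have n: "g n = of_real (real q powr (real n / 2)) * (of_real (sph_coeff n n) * E (2 * int n - int n) z)"
      by (simp add: g sph_coeff_def)
    have l: "(of_nat q - 1) * of_nat q ^ (m - l - 1) * g (Suc l) =
        of_real (real q powr (real n / 2)) * (of_real (sph_coeff n (Suc l)) * E (2 * int (Suc l) - int n) z)" if "l < m" for l
    proof -
      have "(real q - 1) * real q powr real (m - l - 1) * real q powr (real (Suc l) - real n / 2) =
            (real q - 1) * real q powr (real n / 2 - 1)"
        using that by (simp add: Suc of_nat_diff field_simps flip: powr_add)
      also have "\<dots> = real q powr (real n / 2) * sph_coeff n (Suc l)"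
      proof -
        have "real q powr (real n / 2 - 1) = real q powr (real n / 2) / real q"
          using q2 by (simp add: powr_diff)
        moreover have "sph_coeff n (Suc l) = 1 - 1 / real q" using that by (simp add: sph_coeff_def Suc)
        ultimately show ?thesis by (simp only:) (use q2 in \<open>simp add: field_simps\<close>)
      qed
      finally have "complex_of_real ((real q - 1) * real q powr real (m - l - 1) * real q powr (real (Suc l) - real n / 2)) =
          of_real (real q powr (real n / 2) * sph_coeff n (Suc l))" by (rule arg_cong)
      then show ?thesis unfolding g qp by (simp add: mult_ac)
    qed
    have "(\<Sum>y\<in>sphere_t q n. g (lcp x y)) = of_nat q ^ Suc m * g 0 +
        (\<Sum>l<m. (of_nat q - 1) * of_nat q ^ (m - l - 1) * g (Suc l)) + g (Suc m)"
      using x q2 unfolding Suc by (intro sum_sphere_t_lcp) auto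
    also have "\<dots> = of_real (real q powr (real n / 2)) *
        (of_real (sph_coeff n 0) * E (2 * int 0 - int n) z + (\<Sum>l<m. of_real (sph_coeff n (Suc l)) * E (2 * int (Suc l) - int n) z)
         + of_real (sph_coeff n n) * E (2 * int n - int n) z)"
      unfolding 0 n[unfolded Suc, folded Suc] using n l by (simp add: Suc distrib_left sum_distrib_left)
    also have "\<dots> = of_real (real q powr (real n / 2)) * sph_poly 0 n z"
    proof -
      have "(\<Sum>l\<le>Suc m. f l) = f 0 + (\<Sum>l<m. f (Suc l)) + f (Suc m)" for f :: "nat \<Rightarrow> complex"
        by (subst sum.atMost_Suc, subst lessThan_Suc_atMost[symmetric], subst sum.lessThan_Suc_shift, rule refl)
      then show ?thesis by (simp only: sph_poly_def Suc power_0 mult_1_right)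
    qed
    finally show ?thesis .
  qed
  finally show ?thesis .
qed

definition profile :: "(nat list \<Rightarrow> complex) \<Rightarrow> nat \<Rightarrow> complex" where
  "profile f n = of_real (real q powr (real n / 2)) * f (SOME x. x \<in> sphere_t q n)"

definition of_profile :: "(nat \<Rightarrow> complex) \<Rightarrow> nat list \<Rightarrow> complex" where
  "of_profile G x = (if x \<in> verts q then of_real (real q powr (- (real (length x) / 2))) * G (length x) else 0)"

lemma some_sphere: "(SOME x. x \<in> sphere_t q n) \<in> sphere_t q n"
  using sphere_t_nonempty some_in_eq by blast

lemma sphere_t_verts: "x \<in> sphere_t q n \<Longrightarrow> x \<in> verts q" "x \<in> sphere_t q n \<Longrightarrow> length x = n"
  "x \<in> verts q \<Longrightarrow> x \<in> sphere_t q (length x)"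
  by (auto simp: sphere_t_def)

lemma profile_length:
  assumes "radial q f" "x \<in> verts q"
  shows "profile f (length x) = of_real (real q powr (real (length x) / 2)) * f x"
proof -
  have "f (SOME y. y \<in> sphere_t q (length x)) = f x"
    using assms some_sphere[of "length x"] sphere_t_verts unfolding radial_def by metis
  then show ?thesis by (simp add: profile_def)
qed

lemma weight_profile:
  assumes "radial q f" "x \<in> verts q"
  shows "(1 + real (length x)) ^ m * real q powr (real (length x) / p) * cmod (f x) =
    weight m (length x) * cmod (profile f (length x))"
proof -
  have "real (length x) / p = d * real (length x) + real (length x) / 2"
    by (simp add: delta_def algebra_simps)
  then show ?thesis
    unfolding weight_def profile_length[OF assms] by (simp add: norm_mult powr_add)
qed

lemma range_length: "length ` verts q = UNIV"
  using some_sphere sphere_t_verts by (metis UNIV_eq_I image_eqI)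

lemma image_weighted:
  assumes "radial q f"
  shows "(\<lambda>x. (1 + real (length x)) ^ m * real q powr (real (length x) / p) * cmod (f x)) ` verts q =
    range (\<lambda>n. weight m n * cmod (profile f n))"
  using weight_profile[OF assms] unfolding range_length[symmetric] image_image by (intro image_cong) auto

lemma rapid_profile: "f \<in> Sp_rad q p \<Longrightarrow> rapid (profile f)"
  by (auto simp: rapid_def Sp_rad_def Sp_space_def image_weighted)

lemma nu_eq_rapid_norm: "radial q f \<Longrightarrow> nu_sn q p m f = rapid_norm m (profile f)"
  unfolding nu_sn_def rapid_norm_def image_weighted ..

lemma radial_of_profile: "radial q (of_profile G)"
  by (auto simp: radial_def of_profile_def)

lemma profile_of_profile: "profile (of_profile G) = G"
proof
  fix n
  show "profile (of_profile G) n = G n"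
    using some_sphere[of n, THEN sphere_t_verts(1)] some_sphere[of n, THEN sphere_t_verts(2)] q2
    by (simp add: profile_def of_profile_def powr_minus field_simps)
qed

lemma of_profile_in_Sp_rad: "rapid G \<Longrightarrow> of_profile G \<in> Sp_rad q p"
  unfolding Sp_rad_def Sp_space_def using radial_of_profile image_weighted[OF radial_of_profile, of _ G]
  by (simp add: profile_of_profile rapid_def) (simp add: of_profile_def)

lemma of_profile_profile:
  assumes "radial q f" "\<And>x. x \<notin> verts q \<Longrightarrow> f x = 0" shows "of_profile (profile f) = f"
proof
  fix x :: "nat list"
  have "complex_of_real (real q powr (- (real (length x) / 2))) * of_real (real q powr (real (length x) / 2)) = 1"
    using q2 by (simp flip: of_real_mult powr_add)
  then show "of_profile (profile f) x = f x"
    using assms by (simp add: of_profile_def profile_length flip: mult.assoc)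
qed

lemma Sp_radD: "f \<in> Sp_rad q p \<Longrightarrow> radial q f" "f \<in> Sp_rad q p \<Longrightarrow> x \<notin> verts q \<Longrightarrow> f x = 0"
  by (auto simp: Sp_rad_def Sp_space_def)

lemma sft_eq_radial_transform:
  assumes f: "f \<in> Sp_rad q p" shows "sft q p f = radial_transform (profile f)"
proof
  fix z
  have rad: "radial q f" using f by (simp add: Sp_rad_def)
  note G = rapid_profile[OF f]
  show "sft q p f z = radial_transform (profile f) z"
  proof (cases "z \<in> S")
    case z: True
    let ?u = "\<lambda>x. f x * sph q z x"
    have u: "of_nat (card (sphere_t q n)) * ?u x = profile f n * sph_poly 0 n z" if "x \<in> sphere_t q n" for n x
    proof -
      have "of_nat (card (sphere_t q n)) * ?u x = f x * (of_nat (card (sphere_t q n)) * sph q z x)" by simp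
      also have "\<dots> = f x * of_real (real q powr (real n / 2)) * sph_poly 0 n z"
        unfolding sph_eq_sph_poly[OF that] by simp
      also have "\<dots> = profile f n * sph_poly 0 n z"
        using profile_length[OF rad sphere_t_verts(1)[OF that]] sphere_t_verts(2)[OF that] by simp
      finally show ?thesis .
    qed
    have card: "card (sphere_t q n) > 0" for n
      using sphere_t_nonempty finite_sphere_t by (simp add: card_gt_0_iff)
    have u': "?u x = profile f n * sph_poly 0 n z / of_nat (card (sphere_t q n))" if "x \<in> sphere_t q n" for n x
      unfolding u[OF that, symmetric] using that by auto
    have sum_u: "(\<Sum>x\<in>sphere_t q n. ?u x) = profile f n * sph_poly 0 n z" for n
      using card[of n] sphere_t_nonempty[of n] by (simp add: u')
    have sum_nu: "(\<Sum>x\<in>sphere_t q n. cmod (?u x)) = cmod (profile f n * sph_poly 0 n z)" for n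
      using card[of n] sphere_t_nonempty[of n] by (simp add: u' norm_divide)
    have norm_summable: "summable (\<lambda>n. cmod (profile f n * sph_poly 0 n z))"
      by (rule summable_comparison_test'[OF summable_bound])
         (use cmod_term_le[OF G z, of _ 0] in auto)
    have img: "snd ` Sigma UNIV (sphere_t q) = verts q"
      using sphere_t_verts by (force simp: image_iff)
    have inj: "inj_on snd (Sigma UNIV (sphere_t q))"
      using sphere_t_verts(2) by (auto simp: inj_on_def)
    have "(\<lambda>(n, x). cmod (?u x)) summable_on Sigma UNIV (sphere_t q)"
    proof (rule summable_on_SigmaI)
      show "((\<lambda>x. case (n, x) of (n, x) \<Rightarrow> cmod (?u x)) has_sum cmod (profile f n * sph_poly 0 n z)) (sphere_t q n)" for n
        using has_sum_finite[OF finite_sphere_t, of "\<lambda>x. cmod (?u x)" q n] by (simp add: sum_nu)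
      show "(\<lambda>n. cmod (profile f n * sph_poly 0 n z)) summable_on UNIV"
        using norm_summable by (intro summable_on_UNIV_nonneg_real_iff[THEN iffD2]) auto
    qed auto
    then have "(\<lambda>nx. norm (case nx of (n, x) \<Rightarrow> ?u x)) summable_on Sigma UNIV (sphere_t q)"
      by (simp add: case_prod_unfold)
    then have sm: "(\<lambda>(n, x). ?u x) summable_on Sigma UNIV (sphere_t q)"
      by (rule abs_summable_summable)
    have "infsum ?u (verts q) = infsum (?u \<circ> snd) (Sigma UNIV (sphere_t q))"
      unfolding img[symmetric] by (rule infsum_reindex[OF inj])
    also have "\<dots> = infsum (\<lambda>(n, x). ?u x) (Sigma UNIV (sphere_t q))"
      by (simp add: o_def case_prod_unfold)
    also have "\<dots> = infsum (\<lambda>n. infsum ?u (sphere_t q n)) UNIV"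
      by (rule infsum_Sigma'_banach[OF sm, symmetric])
    also have "\<dots> = infsum (\<lambda>n. profile f n * sph_poly 0 n z) UNIV"
      by (simp add: sum_u)
    also have "\<dots> = synth 0 (profile f) z"
      by (intro infsumI norm_summable_imp_has_sum norm_summable synth_sums G z)
    finally show ?thesis using z by (simp add: sft_def radial_transform_def)
  qed (simp add: sft_def radial_transform_def)
qed

lemma Sp_rad_lincomb:
  assumes f: "f \<in> Sp_rad q p" and g: "g \<in> Sp_rad q p"
  shows "(\<lambda>x. a * f x + b * g x) \<in> Sp_rad q p"
proof -
  have profile: "profile (\<lambda>x. a * f x + b * g x) n = a * profile f n + b * profile g n" for n
    by (simp add: profile_def algebra_simps)
  have rapid: "rapid (profile (\<lambda>x. a * f x + b * g x))"
  proof (rule rapidI)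
    fix m n
    have "weight m n * cmod (a * profile f n + b * profile g n) \<le> weight m n * (cmod a * cmod (profile f n) + cmod b * cmod (profile g n))"
      using weight_pos[of m n] by (intro mult_left_mono) (auto intro: norm_triangle_mono simp: norm_mult)
    also have "\<dots> = cmod a * (weight m n * cmod (profile f n)) + cmod b * (weight m n * cmod (profile g n))"
      by (simp add: algebra_simps)
    also have "\<dots> \<le> cmod a * rapid_norm m (profile f) + cmod b * rapid_norm m (profile g)"
      by (intro add_mono mult_left_mono le_rapid_norm rapid_profile f g) auto
    finally show "weight m n * cmod (profile (\<lambda>x. a * f x + b * g x) n) \<le> cmod a * rapid_norm m (profile f) + cmod b * rapid_norm m (profile g)"
      unfolding profile .
  qed
  have radial: "radial q (\<lambda>x. a * f x + b * g x)"
    unfolding radial_def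
  proof (intro ballI impI)
    fix x y assume "x \<in> verts q" "y \<in> verts q" "length x = length y"
    then have "f x = f y" "g x = g y"
      using Sp_radD(1)[OF f] Sp_radD(1)[OF g] unfolding radial_def by blast+
    then show "a * f x + b * g x = a * f y + b * g y" by (simp only:)
  qed
  have "of_profile (profile (\<lambda>x. a * f x + b * g x)) = (\<lambda>x. a * f x + b * g x)"
    using Sp_radD(2)[OF f] Sp_radD(2)[OF g] by (intro of_profile_profile radial) auto
  then show ?thesis using of_profile_in_Sp_rad[OF rapid] by simp
qed

lemma sft_lincomb:
  assumes f: "f \<in> Sp_rad q p" and g: "g \<in> Sp_rad q p"
  shows "sft q p (\<lambda>x. a * f x + b * g x) = (\<lambda>z. a * sft q p f z + b * sft q p g z)"
proof
  fix z
  have profile: "profile (\<lambda>x. a * f x + b * g x) n = a * profile f n + b * profile g n" for n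
    by (simp add: profile_def algebra_simps)
  show "sft q p (\<lambda>x. a * f x + b * g x) z = a * sft q p f z + b * sft q p g z"
  proof (cases "z \<in> S")
    case z: True
    have "(\<lambda>n. a * (profile f n * sph_poly 0 n z) + b * (profile g n * sph_poly 0 n z)) sums (a * synth 0 (profile f) z + b * synth 0 (profile g) z)"
      by (intro sums_add sums_mult synth_sums rapid_profile f g z)
    then have "synth 0 (profile (\<lambda>x. a * f x + b * g x)) z = a * synth 0 (profile f) z + b * synth 0 (profile g) z"
      unfolding synth_def[of 0 "profile (\<lambda>x. a * f x + b * g x)"] profile by (simp add: sums_iff algebra_simps)
    then show ?thesis
      using z by (simp add: sft_eq_radial_transform f g Sp_rad_lincomb radial_transform_def)
  qed (simp add: sft_def)
qed

lemma homeomorphic_sft: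
  "homeomorphic_map (seminorm_topology (Sp_rad q p) (nu_sn q p)) (seminorm_topology (H_rad q p) (mu_sn p)) (sft q p)"
proof -
  let ?X = "seminorm_topology (Sp_rad q p) (nu_sn q p)"
  let ?Y = "seminorm_topology (H_rad q p) (mu_sn p)"
  have sft: "sft q p f \<in> H_rad q p" if "f \<in> Sp_rad q p" for f
    by (simp add: sft_eq_radial_transform that radial_transform_in_H_rad rapid_profile)
  have sub: "g - f \<in> Sp_rad q p" "sft q p (g - f) = sft q p g - sft q p f"
    if "f \<in> Sp_rad q p" "g \<in> Sp_rad q p" for f g
    using Sp_rad_lincomb[OF that(2,1), of 1 "-1"] sft_lincomb[OF that(2,1), of 1 "-1"]
    by (simp_all add: fun_diff_def)
  have inv: "of_profile (inv_coeffs h) \<in> Sp_rad q p" "sft q p (of_profile (inv_coeffs h)) = h" if "h \<in> H_rad q p" for h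
    using that by (simp_all add: of_profile_in_Sp_rad rapid_inv_coeffs sft_eq_radial_transform profile_of_profile radial_transform_inv_coeffs)
  have inv': "of_profile (inv_coeffs (sft q p f)) = f" if "f \<in> Sp_rad q p" for f
    using that by (simp add: sft_eq_radial_transform inv_coeffs_radial_transform rapid_profile of_profile_profile Sp_radD)
  have H_sub: "g - f \<in> H_rad q p" if "f \<in> H_rad q p" "g \<in> H_rad q p" for f g
    using H_rad_diff[OF that] by (simp add: fun_diff_def)
  have "continuous_map ?X ?Y (sft q p)"
  proof (rule continuous_map_seminorm_topology[OF sft sub])
    fix k
    have "sum_inv_squares \<ge> 0" unfolding sum_inv_squares_def by (intro suminf_nonneg summable_sum_inv_squares) auto
    moreover have "mu_sn p k (sft q p h) \<le> L ^ k * sum_inv_squares * (\<Sum>j\<le>k + 3. nu_sn q p j h)" if h: "h \<in> Sp_rad q p" for h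
    proof -
      have rad: "radial q h" using h by (simp add: Sp_rad_def)
      have nonneg: "0 \<le> nu_sn q p j h" for j
        unfolding nu_eq_rapid_norm[OF rad] using le_rapid_norm[OF rapid_profile[OF h], of j 0] weight_pos[of j 0]
        by (meson less_imp_le mult_nonneg_nonneg norm_ge_zero order_trans)
      have "mu_sn p k (sft q p h) \<le> L ^ k * sum_inv_squares * nu_sn q p (k + 3) h"
        unfolding sft_eq_radial_transform[OF h] nu_eq_rapid_norm[OF rad] by (rule mu_radial_transform_le[OF rapid_profile[OF h]])
      also have "\<dots> \<le> L ^ k * sum_inv_squares * (\<Sum>j\<le>k + 3. nu_sn q p j h)"
        using \<open>sum_inv_squares \<ge> 0\<close> L_pos by (intro mult_left_mono member_le_sum nonneg) auto
      finally show ?thesis .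
    qed
    ultimately show "\<exists>C m. C \<ge> 0 \<and> (\<forall>h\<in>Sp_rad q p. mu_sn p k (sft q p h) \<le> C * (\<Sum>j\<le>m. nu_sn q p j h))"
      using L_pos by (intro exI[of _ "L ^ k * sum_inv_squares"] exI[of _ "k + 3"]) auto
  qed
  moreover have "continuous_map ?Y ?X (\<lambda>h. of_profile (inv_coeffs h))"
  proof (rule continuous_map_seminorm_topology[OF inv(1) H_sub])
    fix f g assume f: "f \<in> H_rad q p" and g: "g \<in> H_rad q p"
    have "sft q p (of_profile (inv_coeffs g) - of_profile (inv_coeffs f)) = g - f"
      using sub(2)[OF inv(1)[OF f] inv(1)[OF g]] inv(2) f g by simp
    then show "of_profile (inv_coeffs (g - f)) = of_profile (inv_coeffs g) - of_profile (inv_coeffs f)"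
      using inv'[OF sub(1)[OF inv(1)[OF f] inv(1)[OF g]]] by simp
  next
    fix k
    have "nu_sn q p k (of_profile (inv_coeffs h)) \<le> (4 * 2 ^ k * (1 + 1 / L ^ k)) * (\<Sum>j\<le>k. mu_sn p j h)"
      if h: "h \<in> H_rad q p" for h
    proof -
      have "mu_sn p j h \<le> (\<Sum>j\<le>k. mu_sn p j h)" if "j \<le> k" for j
        using that by (intro member_le_sum mu_nonneg h) auto
      then have "4 * (2 ^ k * (mu_sn p 0 h + mu_sn p k h / L ^ k)) \<le>
          4 * (2 ^ k * ((\<Sum>j\<le>k. mu_sn p j h) + (\<Sum>j\<le>k. mu_sn p j h) / L ^ k))"
        using L_pos by (intro mult_left_mono add_mono divide_right_mono) auto
      then show ?thesis
        unfolding nu_eq_rapid_norm[OF radial_of_profile] profile_of_profile using rapid_norm_le[OF weight_inv_coeffs_le[OF h], of k]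
        by (simp add: algebra_simps)
    qed
    then show "\<exists>C m. C \<ge> 0 \<and> (\<forall>h\<in>H_rad q p. nu_sn q p k (of_profile (inv_coeffs h)) \<le> C * (\<Sum>j\<le>m. mu_sn p j h))"
      using L_pos by (intro exI[of _ "4 * 2 ^ k * (1 + 1 / L ^ k)"] exI[of _ k]) auto
  qed
  ultimately have "homeomorphic_maps ?X ?Y (sft q p) (\<lambda>h. of_profile (inv_coeffs h))"
    by (simp add: homeomorphic_maps_def inv inv')
  then show ?thesis by (rule homeomorphic_maps_imp_map)
qed

end

theorem theorem5p1:
  fixes q :: nat and p :: real
  assumes "2 \<le> q" and "1 < p" and "p \<le> 2"
  shows "homeomorphic_map (seminorm_topology (Sp_rad q p) (nu_sn q p))
                          (seminorm_topology (H_rad q p) (mu_sn p)) (sft q p)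
       \<and> (\<forall>f\<in>Sp_rad q p. \<forall>g\<in>Sp_rad q p. \<forall>a b.
            sft q p (\<lambda>x. a * f x + b * g x) = (\<lambda>z. a * sft q p f z + b * sft q p g z))"
proof -
  interpret tree_strip q p using assms by unfold_locales
  show ?thesis using homeomorphic_sft sft_lincomb by blast
qed

end
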